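(* Let $\mathcal M$ be an o-minimal structure such that $\mathfrak n_{\dim}(\mathcal M)$ is finite. Then there exists a positive integer $m$ such that $\mathfrak n_{\dim}(\mathcal M)=2^m-1$.
   Context: "Definable" means definable in the structure with parameters; $\mathbb N$ is the set of nonnegative integers. Let $\mathcal M=(M,\ldots)$ be a structure, $\mathrm{Def}_n(\mathcal M)$ the collection of definable subsets of $M^n$, and $\mathrm{Def}(\mathcal M)=\bigcup_{n>0}\mathrm{Def}_n(\mathcal M)$. Let $\Pi:M^n\to M^{n-1}$ be the projection forgetting the last coordinate, and for $X\subseteq M^n$, $x\in\Pi(X)$, put $X_x^{\Pi}=\{y\in M: (x,y)\in X\}$. Convention: $-\infty+i=-\infty$. A *dimension function* on $\mathcal M$ is a function $\dim:\mathrm{Def}(\mathcal M)\to\mathbb N\cup\{-\infty\}$ such that for every $n>0$: (1) $\dim(\emptyset)=-\infty$, $\dim(\{a\})=0$ for each $a\in M$, and $\dim(M)=1$; $(2)_n$ $\dim(X\cup Y)=\max\{\dim X,\dim Y\}$ for $X,Y\in\mathrm{Def}_n(\mathcal M)$; $(3)_n$ $\dim X=\dim X^{\sigma}$ for each $X\in\mathrm{Def}_n(\mathcal M)$ and each permutation $\sigma$ of $\{1,\dots,n\}$, where $X^\sigma=\{(x_{\sigma(1)},\dots,x_{\sigma(n)}):(x_1,\dots,x_n)\in X\}$; $(4)_n$ if $n>1$ and $X\in\mathrm{Def}_n(\mathcal M)$, then for $i=0,1$ the set $X(i)=\{x\in\Pi(X):\dim X_x^{\Pi}=i\}$ belongs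 to $\mathrm{Def}_{n-1}(\mathcal M)$ and $\dim(X\cap\Pi^{-1}(X(i)))=\dim(X(i))+i$. $\mathfrak n_{\dim}(\mathcal M)$ is the cardinality of the set of dimension functions on $\mathcal M$. A structure $\mathcal M=(M,<,\ldots)$ expanding a dense linear order without endpoints is *o-minimal* if every definable subset of $M$ is a union of a finite set and finitely many open intervals (with endpoints in $M\cup\{\pm\infty\}$). *)

theory Defs
  imports Main "HOL-Library.FuncSet" "HOL-Library.Option_ord" "HOL-Combinatorics.Permutations"
begin

section \<open>First-order structures and definable sets\<close>

datatype 'f tm = Var nat | App 'f "'f tm list"

datatype ('f, 'r) fm =
    Eq "'f tm" "'f tm"
  | Rel 'r "'f tm list"
  | Neg "('f, 'r) fm"
  | Conj "('f, 'r) fm" "('f, 'r) fm"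
  | Exists nat "('f, 'r) fm"

text \<open>The universe is the whole type \<open>'a\<close>. The language is given by the sets \<open>funs\<close> and
  \<open>rels\<close>, either of which may be empty; interpretations are only consulted for symbols of
  the language applied to argument lists of the right length.\<close>

record ('a, 'f, 'r) fo_structure =
  funs :: "'f set"
  fun_arity :: "'f \<Rightarrow> nat"
  fun_interp :: "'f \<Rightarrow> 'a list \<Rightarrow> 'a"
  rels :: "'r set"
  rel_arity :: "'r \<Rightarrow> nat"
  rel_interp :: "'r \<Rightarrow> 'a list \<Rightarrow> bool"

fun wf_tm :: "('a, 'f, 'r) fo_structure \<Rightarrow> 'f tm \<Rightarrow> bool" where
  "wf_tm S (Var i) \<longleftrightarrow> True"
| "wf_tm S (App f ts) \<longleftrightarrow>
     f \<in> funs S \<and> length ts = fun_arity S f \<and> list_all (wf_tm S) ts"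

primrec wf_fm :: "('a, 'f, 'r) fo_structure \<Rightarrow> ('f, 'r) fm \<Rightarrow> bool" where
  "wf_fm S (Eq s t) \<longleftrightarrow> wf_tm S s \<and> wf_tm S t"
| "wf_fm S (Rel r ts) \<longleftrightarrow> r \<in> rels S \<and> length ts = rel_arity S r \<and> list_all (wf_tm S) ts"
| "wf_fm S (Neg p) \<longleftrightarrow> wf_fm S p"
| "wf_fm S (Conj p q) \<longleftrightarrow> wf_fm S p \<and> wf_fm S q"
| "wf_fm S (Exists i p) \<longleftrightarrow> wf_fm S p"

primrec val :: "('a, 'f, 'r) fo_structure \<Rightarrow> (nat \<Rightarrow> 'a) \<Rightarrow> 'f tm \<Rightarrow> 'a" where
  "val S e (Var i) = e i"
| "val S e (App f ts) = fun_interp S f (map (val S e) ts)"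

primrec sat :: "('a, 'f, 'r) fo_structure \<Rightarrow> (nat \<Rightarrow> 'a) \<Rightarrow> ('f, 'r) fm \<Rightarrow> bool" where
  "sat S e (Eq s t) \<longleftrightarrow> val S e s = val S e t"
| "sat S e (Rel r ts) \<longleftrightarrow> rel_interp S r (map (val S e) ts)"
| "sat S e (Neg p) \<longleftrightarrow> \<not> sat S e p"
| "sat S e (Conj p q) \<longleftrightarrow> sat S e p \<and> sat S e q"
| "sat S e (Exists i p) \<longleftrightarrow> (\<exists>a. sat S (e(i := a)) p)"

text \<open>Points of \<open>M\<^sup>n\<close> are lists of length \<open>n\<close>. In the definition of a subset of \<open>M\<^sup>n\<close>, the
  variables below \<open>n\<close> denote the coordinates and the remaining free variables, finitely many
  in each formula, denote parameters, whose values are supplied by \<open>e\<close>.\<close>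

definition definable_sets :: "('a, 'f, 'r) fo_structure \<Rightarrow> nat \<Rightarrow> 'a list set set" where
  "definable_sets S n =
     {{xs. length xs = n \<and> sat S (\<lambda>i. if i < n then xs ! i else e i) p} | p e. wf_fm S p}"

definition all_definable_sets :: "('a, 'f, 'r) fo_structure \<Rightarrow> 'a list set set" where
  "all_definable_sets S = (\<Union>n\<in>{0<..}. definable_sets S n)"


section \<open>Dimension functions\<close>

text \<open>Values in \<open>\<nat> \<union> {-\<infinity>}\<close> are of type \<^typ>\<open>nat option\<close>, where \<open>None\<close> is \<open>-\<infinity>\<close>; it is the least
  element in the order of \<^theory>\<open>HOL-Library.Option_ord\<close>.\<close>

definition shift_dim :: "nat option \<Rightarrow> nat \<Rightarrow> nat option" where
  "shift_dim d i = map_option (\<lambda>k. k + i) d"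

text \<open>On points of \<open>M\<^sup>n\<close>, the projection forgetting the last coordinate is \<^const>\<open>butlast\<close>.\<close>

definition fibre :: "'a list set \<Rightarrow> 'a list \<Rightarrow> 'a list set" where
  "fibre X x = {[y] | y. x @ [y] \<in> X}"

definition fibre_dim_set :: "('a list set \<Rightarrow> nat option) \<Rightarrow> 'a list set \<Rightarrow> nat \<Rightarrow> 'a list set" where
  "fibre_dim_set dim X i = {x \<in> butlast ` X. dim (fibre X x) = Some i}"

definition dimension_function ::
    "('a, 'f, 'r) fo_structure \<Rightarrow> ('a list set \<Rightarrow> nat option) \<Rightarrow> bool" where
  "dimension_function S dim \<longleftrightarrow>
     dim {} = None \<and> (\<forall>a. dim {[a]} = Some 0) \<and> dim {xs. length xs = 1} = Some 1 \<and>
     (\<forall>n>0. \<forall>X\<in>definable_sets S n. \<forall>Y\<in>definable_sets S n.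
        dim (X \<union> Y) = max (dim X) (dim Y)) \<and>
     (\<forall>n>0. \<forall>X\<in>definable_sets S n. \<forall>\<sigma>. \<sigma> permutes {..<n} \<longrightarrow>
        dim (permute_list \<sigma> ` X) = dim X) \<and>
     (\<forall>n>1. \<forall>X\<in>definable_sets S n. \<forall>i\<in>{0, 1}.
        fibre_dim_set dim X i \<in> definable_sets S (n - 1) \<and>
        dim {x \<in> X. butlast x \<in> fibre_dim_set dim X i} =
          shift_dim (dim (fibre_dim_set dim X i)) i)"

text \<open>A dimension function has domain \<^term>\<open>all_definable_sets S\<close>. So that distinct HOL functions
  are distinct dimension functions, they take the value \<^const>\<open>undefined\<close> elsewhere.\<close>

definition dimension_functions ::
    "('a, 'f, 'r) fo_structure \<Rightarrow> ('a list set \<Rightarrow> nat option) set" where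
  "dimension_functions S = {dim \<in> extensional (all_definable_sets S). dimension_function S dim}"

definition n_dim :: "('a, 'f, 'r) fo_structure \<Rightarrow> nat" where
  "n_dim S = card (dimension_functions S)"


section \<open>O-minimality\<close>

definition open_interval :: "'a::linorder set \<Rightarrow> bool" where
  "open_interval I \<longleftrightarrow>
     I = UNIV \<or> (\<exists>a. I = {a<..}) \<or> (\<exists>b. I = {..<b}) \<or> (\<exists>a b. I = {a<..<b})"

definition expands_order :: "('a::linorder, 'f, 'r) fo_structure \<Rightarrow> bool" where
  "expands_order S \<longleftrightarrow>
     (\<exists>r\<in>rels S. rel_arity S r = 2 \<and> (\<forall>x y. rel_interp S r [x, y] \<longleftrightarrow> x < y))"

definition o_minimal :: "('a::unbounded_dense_linorder, 'f, 'r) fo_structure \<Rightarrow> bool" where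
  "o_minimal S \<longleftrightarrow>
     expands_order S \<and>
     (\<forall>X\<in>definable_sets S 1. \<exists>F \<I>. finite F \<and> finite \<I> \<and> (\<forall>I\<in>\<I>. open_interval I) \<and>
        {y. [y] \<in> X} = F \<union> \<Union>\<I>)"

end

theory Submission
  imports Defs
begin

text \<open>A dimension function \<open>d\<close> is determined by the set \<open>W\<close> of those \<open>x\<close> for which every interval \<open>]b, x[\<close> has
  dimension \<open>1\<close>: a definable subset of \<open>M\<close> has dimension at most \<open>0\<close> iff it meets \<open>W\<close> in a finite set. The
  sets \<open>W\<close> that occur are, up to finite sets, the infinite definable sets \<open>V\<close> that are separated from
  their complement, in the sense that a definable finite-to-finite correspondence between \<open>- V\<close> and \<open>V\<close>
  has finite projections. These sets form a Boolean algebra, so if there are finitely many of them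
  modulo finite sets, their number is a power of \<open>2\<close>; the zero element is the only one that does not
  come from a dimension function.

  The main point is that such a \<open>V\<close> gives a dimension invariant under permutations of the coordinates.
  This reduces to definable subsets of \<open>M\<^sup>2\<close>, where it follows from the statement that infinitely many
  infinite sections in one direction force infinitely many infinite sections in the other. That in
  turn rests on the fact that a definable family of pairwise disjoint sets has only finitely many
  infinite members.\<close>

section \<open>Definable predicates\<close>

text \<open>Separation is the right condition because the fibre axiom, read in both coordinate
  orders, gives the two projections of a finite-to-finite relation the same dimension. Neither
  monotonicity nor cell decomposition is used; three facts about a definable subset of the line
  carry the argument. It is infinite iff it contains an interval, so "infinitely many" is a
  definable quantifier. It has an infimum if it is nonempty and bounded below. To the left of each
  point it is eventually full or eventually empty. The last fact explains the one-sided intervals: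
  the set of points whose left germ lies in \<open>V\<close> depends on \<open>V\<close> only modulo
  finite sets and commutes with Boolean operations, which yields canonical representatives without a
  quotient. For a given dimension function the obstacle is that each point off \<open>W\<close> has
  a small left interval, but infinitely many small sets cannot simply be united. Computing the
  dimension of a triangle by fibring over either coordinate turns local smallness into global
  smallness.\<close>

primrec rename_tm :: "(nat \<Rightarrow> nat) \<Rightarrow> 'f tm \<Rightarrow> 'f tm" where
  "rename_tm \<rho> (Var i) = Var (\<rho> i)"
| "rename_tm \<rho> (App f ts) = App f (map (rename_tm \<rho>) ts)"

lemma val_rename_tm: "val S e (rename_tm \<rho> t) = val S (e \<circ> \<rho>) t"
  by (induction t) (auto cong: map_cong intro!: arg_cong[where f = "fun_interp S _"])

lemma wf_rename_tm: "wf_tm S t \<Longrightarrow> wf_tm S (rename_tm \<rho> t)"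
  by (induction t) (auto simp: list_all_iff)

lemma map_val_rename: "map (val S e) (map (rename_tm \<rho>) ts) = map (val S (e \<circ> \<rho>)) ts"
  by (simp add: val_rename_tm)

lemma val_finite_support: "\<exists>N. \<forall>e e'. (\<forall>i<N. e i = e' i) \<longrightarrow> val S e t = val S e' t"
proof (induction t)
  case (Var i)
  show ?case by (rule exI[of _ "Suc i"]) auto
next
  case (App f ts)
  then obtain N where N: "\<And>t. t \<in> set ts \<Longrightarrow> \<forall>e e'. (\<forall>i<N t. e i = e' i) \<longrightarrow> val S e t = val S e' t"
    by metis
  have "N t \<le> Max (N ` set ts)" if "t \<in> set ts" for t
    using that by simp
  then have "map (val S e) ts = map (val S e') ts" if "\<forall>i<Max (N ` set ts). e i = e' i" for e e'
    using N that by (intro map_cong refl) (meson order_less_le_trans)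
  then show ?case
    by (intro exI[of _ "Max (N ` set ts)"]) (simp del: map_eq_conv, metis)
qed

lemma map_val_finite_support:
  "\<exists>N. \<forall>e e'. (\<forall>i<N. e i = e' i) \<longrightarrow> map (val S e) ts = map (val S e') ts"
proof (induction ts)
  case (Cons t ts)
  then obtain N where N: "\<forall>e e'. (\<forall>i<N. e i = e' i) \<longrightarrow> map (val S e) ts = map (val S e') ts"
    by blast
  obtain K where K: "\<forall>e e'. (\<forall>i<K. e i = e' i) \<longrightarrow> val S e t = val S e' t"
    using val_finite_support by blast
  show ?case
    by (rule exI[of _ "max N K"]) (use N K in auto)
qed simp

text \<open>Its purpose is to guarantee a fresh variable for renaming under a quantifier.\<close>

lemma sat_finite_support: "\<exists>N. \<forall>e e'. (\<forall>i<N. e i = e' i) \<longrightarrow> sat S e p = sat S e' p"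
proof (induction p)
  case (Eq s t)
  obtain N where N: "\<forall>e e'. (\<forall>i<N. e i = e' i) \<longrightarrow> val S e s = val S e' s"
    using val_finite_support by blast
  obtain K where K: "\<forall>e e'. (\<forall>i<K. e i = e' i) \<longrightarrow> val S e t = val S e' t"
    using val_finite_support by blast
  have "sat S e (Eq s t) = sat S e' (Eq s t)" if "\<forall>i<max N K. e i = e' i" for e e'
    using N[rule_format, of e e'] K[rule_format, of e e'] that by simp
  then show ?case
    by blast
next
  case (Rel r ts)
  show ?case
    using map_val_finite_support[of S ts] unfolding sat.simps by metis
next
  case (Conj p q)
  then obtain N K where N: "\<forall>e e'. (\<forall>i<N. e i = e' i) \<longrightarrow> sat S e p = sat S e' p"
    and K: "\<forall>e e'. (\<forall>i<K. e i = e' i) \<longrightarrow> sat S e q = sat S e' q"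
    by blast
  have "sat S e (Conj p q) = sat S e' (Conj p q)" if "\<forall>i<max N K. e i = e' i" for e e'
    using N[rule_format, of e e'] K[rule_format, of e e'] that by simp
  then show ?case
    by blast
next
  case (Exists j p)
  then obtain N where "\<forall>e e'. (\<forall>i<N. e i = e' i) \<longrightarrow> sat S e p = sat S e' p"
    by blast
  then have "sat S (e(j := a)) p = sat S (e'(j := a)) p" if "\<forall>i<N. e i = e' i" for e e' a
    using that by simp
  then show ?case
    by (intro exI[of _ N]) auto
qed auto

text \<open>Only an equivalent formula is asserted, because the bound variable has to change:
  keeping it could capture an image under \<open>\<rho>\<close>.\<close>

lemma ex_rename_fm: "wf_fm S p \<Longrightarrow> \<exists>q. wf_fm S q \<and> (\<forall>e. sat S e q = sat S (e \<circ> \<rho>) p)"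
proof (induction p arbitrary: \<rho>)
  case (Eq s t)
  then show ?case
    by (intro exI[of _ "Eq (rename_tm \<rho> s) (rename_tm \<rho> t)"]) (simp add: wf_rename_tm val_rename_tm comp_def)
next
  case (Rel r ts)
  then show ?case
    by (intro exI[of _ "Rel r (map (rename_tm \<rho>) ts)"])
      (simp add: wf_rename_tm map_val_rename list_all_iff comp_def del: map_map)
next
  case (Neg p)
  then obtain q where "wf_fm S q" "\<forall>e. sat S e q = sat S (e \<circ> \<rho>) p"
    by fastforce
  then show ?case
    by (intro exI[of _ "Neg q"]) (simp add: comp_def)
next
  case (Conj p p')
  then obtain q q' where "wf_fm S q" "\<forall>e. sat S e q = sat S (e \<circ> \<rho>) p"
      "wf_fm S q'" "\<forall>e. sat S e q' = sat S (e \<circ> \<rho>) p'"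
    by (metis wf_fm.simps(4))
  then show ?case
    by (intro exI[of _ "Conj q q'"]) (simp add: comp_def)
next
  case (Exists i p)
  obtain N where N: "\<forall>e e'. (\<forall>i<N. e i = e' i) \<longrightarrow> sat S e p = sat S e' p"
    using sat_finite_support by blast
  \<comment> \<open>Fresh for the images of all variables that can influence \<open>p\<close>, so
    assigning a value to \<open>k\<close> disturbs none of them.\<close>
  obtain k where k: "k \<notin> \<rho> ` {..<N}"
    using ex_new_if_finite[of "\<rho> ` {..<N}"] by auto
  obtain q where q: "wf_fm S q" "\<forall>e. sat S e q = sat S (e \<circ> \<rho>(i := k)) p"
    using Exists.IH[of "\<rho>(i := k)"] Exists.prems unfolding wf_fm.simps by blast
  have "sat S (e(k := a) \<circ> \<rho>(i := k)) p = sat S ((e \<circ> \<rho>)(i := a)) p" for e a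
    using N k by (intro N[rule_format]) auto
  then show ?case
    using q by (intro exI[of _ "Exists k q"]) (simp add: comp_def)
qed

text \<open>Parameters are constant functions of the environment, so fixing a coordinate is an
  ordinary substitution without separate bookkeeping.\<close>

definition var_or_const :: "((nat \<Rightarrow> 'a) \<Rightarrow> 'a) \<Rightarrow> bool" where
  "var_or_const t \<longleftrightarrow> (\<exists>i. t = (\<lambda>v. v i)) \<or> (\<exists>c. t = (\<lambda>v. c))"

lemma var_or_const_var: "var_or_const (\<lambda>v. v i)"
  by (auto simp: var_or_const_def)

lemma var_or_const_const: "var_or_const (\<lambda>v. c)"
  by (auto simp: var_or_const_def)

lemma var_or_const_cases:
  assumes "var_or_const t"
  obtains i where "t = (\<lambda>v. v i)" | c where "t = (\<lambda>v. c)"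
  using assms by (auto simp: var_or_const_def)

text \<open>\<open>P\<close> is definable by a formula after replacing each of its variables by an entry of the environment
  or by a parameter.\<close>

definition dfb :: "('a, 'f, 'r) fo_structure \<Rightarrow> ((nat \<Rightarrow> 'a) \<Rightarrow> bool) \<Rightarrow> bool" where
  "dfb S P \<longleftrightarrow> (\<exists>p f. wf_fm S p \<and> (\<forall>i. var_or_const (f i)) \<and> (\<forall>v. P v \<longleftrightarrow> sat S (\<lambda>i. f i v) p))"

lemma dfbI:
  assumes "wf_fm S p" "\<And>i. var_or_const (f i)" "\<And>v. P v \<longleftrightarrow> sat S (\<lambda>i. f i v) p"
  shows "dfb S P"
  using assms unfolding dfb_def by blast

lemma dfbE:
  assumes "dfb S P"
  obtains p f where "wf_fm S p" "\<And>i. var_or_const (f i)" "\<And>v. P v \<longleftrightarrow> sat S (\<lambda>i. f i v) p"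
  using assms unfolding dfb_def by blast

lemma var_or_const_subst:
  assumes "var_or_const t" "\<And>i. var_or_const (\<lambda>v. g v i)"
  shows "var_or_const (\<lambda>v. t (g v))"
  using assms(1) by (cases rule: var_or_const_cases) (auto intro: assms(2) var_or_const_const)

lemma dfb_subst:
  assumes "dfb S P" "\<And>i. var_or_const (\<lambda>v. g v i)"
  shows "dfb S (\<lambda>v. P (g v))"
proof -
  obtain p f where p: "wf_fm S p" "\<And>i. var_or_const (f i)" "\<And>v. P v \<longleftrightarrow> sat S (\<lambda>i. f i v) p"
    using assms(1) by (rule dfbE) blast
  show ?thesis
    by (rule dfbI[of S p "\<lambda>i v. f i (g v)"]) (use p assms(2) in \<open>auto intro: var_or_const_subst\<close>)
qed

lemma dfb_not: "dfb S P \<Longrightarrow> dfb S (\<lambda>v. \<not> P v)"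
  by (elim dfbE, rule_tac p = "Neg p" and f = f in dfbI) auto

lemma dfb_conj:
  assumes "dfb S P" "dfb S Q"
  shows "dfb S (\<lambda>v. P v \<and> Q v)"
proof -
  obtain p f where p: "wf_fm S p" "\<And>i. var_or_const (f i)" "\<And>v. P v \<longleftrightarrow> sat S (\<lambda>i. f i v) p"
    using assms(1) by (rule dfbE) blast
  obtain q g where q: "wf_fm S q" "\<And>i. var_or_const (g i)" "\<And>v. Q v \<longleftrightarrow> sat S (\<lambda>i. g i v) q"
    using assms(2) by (rule dfbE) blast
  \<comment> \<open>Even and odd variables keep apart the values that \<open>f\<close> and
    \<open>g\<close> assign to the same index.\<close>
  obtain p' where p': "wf_fm S p'" "\<And>e. sat S e p' = sat S (e \<circ> (\<lambda>i. 2 * i)) p"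
    using ex_rename_fm[OF p(1)] by metis
  obtain q' where q': "wf_fm S q'" "\<And>e. sat S e q' = sat S (e \<circ> (\<lambda>i. 2 * i + 1)) q"
    using ex_rename_fm[OF q(1)] by metis
  show ?thesis
    by (rule dfbI[of S "Conj p' q'" "\<lambda>i. if even i then f (i div 2) else g (i div 2)"])
      (use p q p' q' in \<open>auto simp: comp_def\<close>)
qed

lemma dfb_ex_upd:
  assumes "dfb S P"
  shows "dfb S (\<lambda>v. \<exists>a. P (v(j := a)))"
proof -
  obtain p f where p: "wf_fm S p" "\<And>i. var_or_const (f i)" "\<And>v. P v \<longleftrightarrow> sat S (\<lambda>i. f i v) p"
    using assms(1) by (rule dfbE) blast
  \<comment> \<open>All variables of \<open>p\<close> that read coordinate \<open>j\<close> merge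
    into the bound variable 0; the others move up by one to make room.\<close>
  let ?\<rho> = "\<lambda>i. if f i = (\<lambda>v. v j) then 0 else Suc i"
  obtain q where q: "wf_fm S q" "\<forall>e. sat S e q = sat S (e \<circ> ?\<rho>) p"
    using ex_rename_fm[OF p(1), of ?\<rho>] by (elim exE conjE)
  let ?f = "\<lambda>i. f (i - 1)"
  have "f i (v(j := a)) = ((\<lambda>i. ?f i v)(0 := a)) (?\<rho> i)" for i v a
  proof (cases "f i = (\<lambda>v. v j)")
    case False
    with p(2)[of i] show ?thesis by (cases rule: var_or_const_cases) auto
  qed simp
  then have "(\<lambda>i. f i (v(j := a))) = (\<lambda>i. ?f i v)(0 := a) \<circ> ?\<rho>" for v a
    by auto
  then have "P (v(j := a)) \<longleftrightarrow> sat S ((\<lambda>i. ?f i v)(0 := a)) q" for v a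
    unfolding p(3) q(2)[rule_format] by presburger
  then show ?thesis
    by (intro dfbI[of S "Exists 0 q" ?f]) (use p(2) q(1) in simp_all)
qed

text \<open>The premise is in de Bruijn form, with the bound variable at coordinate 0, so that
  introduction rules can follow the syntax of nested quantifiers.\<close>

lemma dfb_ex:
  assumes "dfb S (\<lambda>v. Q (\<lambda>i. v (Suc i)) (v 0))"
  shows "dfb S (\<lambda>v. \<exists>a. Q v a)"
proof -
  have "dfb S (\<lambda>v. \<exists>a. Q (\<lambda>i. v (Suc i)) a)"
    using dfb_ex_upd[OF assms, of 0] by simp
  from dfb_subst[OF this, of "\<lambda>v i. v (i - 1)"] show ?thesis
    by (simp add: var_or_const_var)
qed

lemma dfb_disj: "dfb S P \<Longrightarrow> dfb S Q \<Longrightarrow> dfb S (\<lambda>v. P v \<or> Q v)"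
  using dfb_not[OF dfb_conj[OF dfb_not dfb_not], of S P Q] by simp

lemma dfb_imp: "dfb S P \<Longrightarrow> dfb S Q \<Longrightarrow> dfb S (\<lambda>v. P v \<longrightarrow> Q v)"
  using dfb_not[OF dfb_conj[OF _ dfb_not], of S P Q] by simp

lemma dfb_all: "dfb S (\<lambda>v. Q (\<lambda>i. v (Suc i)) (v 0)) \<Longrightarrow> dfb S (\<lambda>v. \<forall>a. Q v a)"
  using dfb_not[OF dfb_ex[OF dfb_not], of S Q] by simp

lemma dfb_eq:
  assumes "var_or_const s" "var_or_const t"
  shows "dfb S (\<lambda>v. s v = t v)"
  by (rule dfbI[of S "Eq (Var 0) (Var 1)" "\<lambda>i. if i = 0 then s else t"]) (use assms in auto)

lemma dfb_const: "dfb S (\<lambda>v. b)"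
  using dfb_eq[of "\<lambda>v. v 0" "\<lambda>v. v 0" S] dfb_not[OF dfb_eq[of "\<lambda>v. v 0" "\<lambda>v. v 0" S]]
  by (cases b) (simp_all add: var_or_const_var)

section \<open>Definable sets of tuples as predicates on environments\<close>

definition tuple_env :: "'a list \<Rightarrow> nat \<Rightarrow> 'a" where
  "tuple_env xs i = (if i < length xs then xs ! i else undefined)"

lemma definable_sets_iff:
  "X \<in> definable_sets S n \<longleftrightarrow>
     (\<exists>P. dfb S P \<and> X = {xs. length xs = n \<and> P (tuple_env xs)})"
proof
  assume "X \<in> definable_sets S n"
  then obtain p e where p: "wf_fm S p"
    and X: "X = {xs. length xs = n \<and> sat S (\<lambda>i. if i < n then xs ! i else e i) p}"
    unfolding definable_sets_def by blast
  let ?f = "\<lambda>i v. if i < n then v i else e i"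
  have "dfb S (\<lambda>v. sat S (\<lambda>i. ?f i v) p)"
  proof (rule dfbI[OF p])
    show "var_or_const (?f i)" for i
      by (cases "i < n") (simp_all add: var_or_const_var var_or_const_const)
  qed simp
  moreover have "X = {xs. length xs = n \<and> sat S (\<lambda>i. ?f i (tuple_env xs)) p}"
    unfolding X by (auto simp: tuple_env_def cong: if_cong)
  ultimately show "\<exists>P. dfb S P \<and> X = {xs. length xs = n \<and> P (tuple_env xs)}"
    by blast
next
  assume "\<exists>P. dfb S P \<and> X = {xs. length xs = n \<and> P (tuple_env xs)}"
  then obtain P where P: "dfb S P" and X: "X = {xs. length xs = n \<and> P (tuple_env xs)}"
    by blast
  obtain p f where p: "wf_fm S p" "\<And>i. var_or_const (f i)" "\<And>v. P v \<longleftrightarrow> sat S (\<lambda>i. f i v) p"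
    using P by (rule dfbE) blast
  \<comment> \<open>A coordinate keeps its index; any other variable \<open>i\<close> gets the
    private slot \<open>n + i\<close>, where its parameter is stored. Reading past the end of the
    tuple also yields a parameter, the default \<open>undefined\<close>.\<close>
  have "\<exists>k c. \<forall>xs. length xs = n \<longrightarrow>
      f i (tuple_env xs) = (if k < n then xs ! k else c) \<and> (k < n \<or> k = n + i)" for i
    using p(2)[of i]
  proof (cases rule: var_or_const_cases)
    case (1 j)
    then show ?thesis
      by (intro exI[of _ "if j < n then j else n + i"] exI[of _ undefined]) (auto simp: tuple_env_def)
  next
    case (2 c)
    then show ?thesis
      by (intro exI[of _ "n + i"] exI[of _ c]) auto
  qed
  then obtain \<rho> c where \<rho>: "\<And>i xs. length xs = n \<Longrightarrow>
      f i (tuple_env xs) = (if \<rho> i < n then xs ! \<rho> i else c i) \<and> (\<rho> i < n \<or> \<rho> i = n + i)"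
    by metis
  obtain q where q: "wf_fm S q" "\<And>e. sat S e q = sat S (e \<circ> \<rho>) p"
    using ex_rename_fm[OF p(1)] by metis
  let ?e = "\<lambda>i. c (i - n)"
  have "P (tuple_env xs) \<longleftrightarrow> sat S (\<lambda>i. if i < n then xs ! i else ?e i) q" if "length xs = n" for xs
  proof -
    have "f i (tuple_env xs) = ((\<lambda>i. if i < n then xs ! i else ?e i) \<circ> \<rho>) i" for i
      using \<rho>[OF that, of i] by auto
    then show ?thesis
      unfolding p(3) q(2) by presburger
  qed
  then show "X \<in> definable_sets S n"
    unfolding X definable_sets_def using q(1)
    by (intro CollectI exI[of _ q] exI[of _ ?e]) (auto cong: conj_cong)
qed

lemma tuple_env_snoc: "tuple_env (x @ [y]) = (tuple_env x)(length x := y)"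
  by (auto simp: tuple_env_def nth_append fun_eq_iff)

section \<open>Definable subsets of the line\<close>

definition def_set :: "('a, 'f, 'r) fo_structure \<Rightarrow> 'a set \<Rightarrow> bool" where
  "def_set S V \<longleftrightarrow> dfb S (\<lambda>v. v 0 \<in> V)"

definition def_rel :: "('a, 'f, 'r) fo_structure \<Rightarrow> ('a \<Rightarrow> 'a \<Rightarrow> bool) \<Rightarrow> bool" where
  "def_rel S R \<longleftrightarrow> dfb S (\<lambda>v. R (v 0) (v (Suc 0)))"

lemma dfb_mem: "def_set S V \<Longrightarrow> var_or_const t \<Longrightarrow> dfb S (\<lambda>v. t v \<in> V)"
  unfolding def_set_def using dfb_subst[of S "\<lambda>v. v 0 \<in> V" "\<lambda>v i. t v"] by simp

lemma dfb_rel: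
  assumes "def_rel S R" "var_or_const s" "var_or_const t"
  shows "dfb S (\<lambda>v. R (s v) (t v))"
proof -
  have "var_or_const (\<lambda>v. (\<lambda>v i. if i = 0 then s v else t v) v i)" for i :: nat
    using assms(2,3) by (cases "i = 0") simp_all
  then show ?thesis
    using dfb_subst[OF assms(1)[unfolded def_rel_def], of "\<lambda>v i. if i = 0 then s v else t v"]
    by simp
qed

text \<open>The entries of the fixed environment \<open>v\<close> turn into parameters.\<close>

lemma dfb_section:
  assumes "dfb S (\<lambda>v. Q (\<lambda>i. v (Suc i)) (v 0))"
  shows "def_set S {y. Q v y}"
proof -
  have "var_or_const (\<lambda>w. (\<lambda>w i. case i of 0 \<Rightarrow> w 0 | Suc j \<Rightarrow> v j) w i)" for i :: nat
    by (cases i) (simp_all add: var_or_const_var var_or_const_const)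
  then show ?thesis
    unfolding def_set_def
    using dfb_subst[OF assms, of "\<lambda>w i. case i of 0 \<Rightarrow> w 0 | Suc j \<Rightarrow> v j"] by simp
qed

lemma finite_Collect_if_unique:
  assumes "\<And>x y. P x \<Longrightarrow> P y \<Longrightarrow> x = y"
  shows "finite {x. P x}"
proof (cases "\<exists>x. P x")
  case True
  then obtain x where "{x. P x} = {x}"
    using assms by blast
  then show ?thesis by simp
qed simp

locale o_minimal_structure =
  fixes S :: "('a::unbounded_dense_linorder, 'f, 'r) fo_structure"
  assumes o_min: "o_minimal S"
begin

lemma dfb_less:
  assumes "var_or_const s" "var_or_const t"
  shows "dfb S (\<lambda>v. s v < t v)"
proof -
  obtain r where r: "r \<in> rels S" "rel_arity S r = 2" "\<And>x y. rel_interp S r [x, y] \<longleftrightarrow> x < y"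
    using o_min unfolding o_minimal_def expands_order_def by blast
  show ?thesis
    by (rule dfbI[of S "Rel r [Var 0, Var 1]" "\<lambda>i. if i = 0 then s else t"]) (use assms r in auto)
qed

lemma dfb_le: "var_or_const s \<Longrightarrow> var_or_const t \<Longrightarrow> dfb S (\<lambda>v. s v \<le> t v)"
  using dfb_not[OF dfb_less[of t s]] by (simp add: not_less)

lemma def_set_decomposition:
  assumes "def_set S V"
  obtains F \<I> where "finite F" "finite \<I>" "\<And>I. I \<in> \<I> \<Longrightarrow> open_interval I" "V = F \<union> \<Union>\<I>"
proof -
  let ?X = "{xs. length xs = 1 \<and> tuple_env xs 0 \<in> V}"
  have "?X \<in> definable_sets S 1"
    unfolding definable_sets_iff using assms def_set_def by blast
  moreover have "{y. [y] \<in> ?X} = V"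
    by (simp add: tuple_env_def)
  ultimately obtain F \<I> where "finite F" "finite \<I>" "\<forall>I\<in>\<I>. open_interval I" "V = F \<union> \<Union>\<I>"
    using o_min[unfolded o_minimal_def, THEN conjunct2] by fast
  then show thesis
    using that by blast
qed

lemma def_set_induct [consumes 1, case_names empty point interval union]:
  assumes "def_set S V"
    and "Q {}" "\<And>a. Q {a}" "\<And>I. open_interval I \<Longrightarrow> Q I" "\<And>A B. Q A \<Longrightarrow> Q B \<Longrightarrow> Q (A \<union> B)"
  shows "Q V"
proof -
  obtain F \<I> where *: "finite F" "finite \<I>" "\<And>I. I \<in> \<I> \<Longrightarrow> open_interval I" "V = F \<union> \<Union>\<I>"
    using assms(1) by (rule def_set_decomposition) blast
  from *(1) have "Q F"
  proof (induction F rule: finite_induct)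
    case (insert x F)
    show ?case
      using assms(5)[OF assms(3)[of x] insert.IH] by simp
  qed (use assms(2) in simp)
  moreover from *(2,3) have "Q (\<Union>\<I>)"
    by (induction \<I> rule: finite_induct) (use assms in auto)
  ultimately show ?thesis
    using *(4) assms(5) by blast
qed

lemma open_interval_cases:
  assumes "open_interval (I :: 'a set)"
  obtains "I = {}" | "\<And>t. \<exists>y\<in>I. y < t" | a where "\<forall>y\<in>I. a \<le> y" "\<forall>t>a. \<exists>y\<in>I. y < t"
proof -
  consider "I = UNIV" | a where "I = {a<..}" | b where "I = {..<b}" | a b where "I = {a<..<b}"
    using assms unfolding open_interval_def by blast
  then show thesis
  proof cases
    case 1
    then show thesis using that(2) by (simp add: lt_ex)
  next
    case (2 a)
    have "\<exists>y>a. y < t" if "a < t" for t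
      using dense[OF that] by blast
    with 2 show thesis by (intro that(3)[of a]) auto
  next
    case (3 b)
    have "\<exists>y<b. y < t" for t
      using lt_ex[of "min b t"] by auto
    with 3 show thesis by (intro that(2)) auto
  next
    case (4 a b)
    show thesis
    proof (cases "a < b")
      case True
      then have "\<exists>y>a. y < b \<and> y < t" if "a < t" for t
        using that dense[of a "min b t"] by auto
      with 4 show thesis by (intro that(3)[of a]) fastforce+
    qed (use 4 that(1) in auto)
  qed
qed

text \<open>The order need not be complete, but the trichotomy empty, unbounded below, or having an
  infimum passes from points and intervals to finite unions.\<close>

lemma def_set_Inf:
  assumes "def_set S V" "y \<in> V" "\<And>y. y \<in> V \<Longrightarrow> t \<le> y"
  obtains s where "\<And>y. y \<in> V \<Longrightarrow> s \<le> y" "\<And>t. s < t \<Longrightarrow> \<exists>y\<in>V. y < t"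
proof -
  let ?Q = "\<lambda>Y. Y = {} \<or> (\<forall>t. \<exists>y\<in>Y. y < t) \<or> (\<exists>s. (\<forall>y\<in>Y. s \<le> y) \<and> (\<forall>t>s. \<exists>y\<in>Y. y < t))"
  have "?Q V"
    using assms(1)
  proof (induction V rule: def_set_induct)
    case (point a)
    then show ?case by (intro disjI2, intro exI[of _ a]) auto
  next
    case (interval I)
    then show ?case by (cases rule: open_interval_cases) blast+
  next
    case (union A B)
    show ?case
    proof (cases "A = {} \<or> B = {} \<or> (\<forall>t. \<exists>y\<in>A \<union> B. y < t)")
      case False
      then obtain s s' where "(\<forall>y\<in>A. s \<le> y) \<and> (\<forall>t>s. \<exists>y\<in>A. y < t)"
          "(\<forall>y\<in>B. s' \<le> y) \<and> (\<forall>t>s'. \<exists>y\<in>B. y < t)"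
        using union by blast
      then show ?thesis
        by (intro disjI2, intro exI[of _ "min s s'"]) (auto simp: min_le_iff_disj min_less_iff_disj)
    qed (use union in auto)
  qed simp
  then show thesis
    using assms(2,3) that by (metis empty_iff leD)
qed

text \<open>For fixed \<open>x\<close>, the sets with such a germ form a Boolean algebra that
  contains all rays, hence all points and intervals.\<close>

lemma left_germ:
  assumes "def_set S V"
  obtains b where "b < x" "(\<forall>y. b < y \<and> y < x \<longrightarrow> y \<in> V) \<or> (\<forall>y. b < y \<and> y < x \<longrightarrow> y \<notin> V)"
proof -
  let ?Q = "\<lambda>Y. \<exists>b<x. (\<forall>y. b < y \<and> y < x \<longrightarrow> y \<in> Y) \<or> (\<forall>y. b < y \<and> y < x \<longrightarrow> y \<notin> Y)"
  obtain l where l: "l < x"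
    using lt_ex by blast
  have ray: "?Q {a<..}" for a
    using l by (cases "a < x") auto
  have ray': "?Q {..<b}" for b
    using l by (cases "b < x") auto
  have int: "?Q (A \<inter> B)" if "?Q A" "?Q B" for A B
  proof -
    from that obtain b b' where
      "b < x" "(\<forall>y. b < y \<and> y < x \<longrightarrow> y \<in> A) \<or> (\<forall>y. b < y \<and> y < x \<longrightarrow> y \<notin> A)"
      "b' < x" "(\<forall>y. b' < y \<and> y < x \<longrightarrow> y \<in> B) \<or> (\<forall>y. b' < y \<and> y < x \<longrightarrow> y \<notin> B)"
      by blast
    then show ?thesis
      by (intro exI[of _ "max b b'"]) auto
  qed
  have compl: "?Q (- A)" if "?Q A" for A
    using that by auto
  have "?Q V"
    using assms
  proof (induction V rule: def_set_induct)
    case empty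
    then show ?case using l by auto
  next
    case (point a)
    have "{a} = - {a<..} \<inter> - {..<a}"
      by auto
    then show ?case
      using int[OF compl[OF ray] compl[OF ray'], of a a] by simp
  next
    case (interval I)
    have "?Q UNIV"
      using l by auto
    then show ?case
      using interval ray ray' int[OF ray ray'] unfolding open_interval_def greaterThanLessThan_def
      by blast
  next
    case (union A B)
    then show ?case
      using compl[OF int[OF compl compl], of A B] by simp
  qed
  then show thesis
    using that by blast
qed

lemma infinite_between: "infinite {a<..<b}" if "a < b" for a b :: 'a
  using that infinite_Ioo by blast

text \<open>Containing an interval is a first-order condition, so infinitude of sections becomes
  definable in families.\<close>

lemma infinite_def_set_iff:
  assumes "def_set S V"
  shows "infinite V \<longleftrightarrow> (\<exists>a b. a < b \<and> (\<forall>y. a < y \<and> y < b \<longrightarrow> y \<in> V))"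
proof
  assume "\<exists>a b. a < b \<and> (\<forall>y. a < y \<and> y < b \<longrightarrow> y \<in> V)"
  then obtain a b where "a < b" "{a<..<b} \<subseteq> V"
    by (metis greaterThanLessThan_iff subsetI)
  then show "infinite V"
    using infinite_between finite_subset by blast
next
  show "infinite V \<Longrightarrow> \<exists>a b. a < b \<and> (\<forall>y. a < y \<and> y < b \<longrightarrow> y \<in> V)"
    using assms
  proof (induction V rule: def_set_induct)
    case (interval I)
    have *: "\<exists>c. a < c" "\<exists>c. c < a" for a :: 'a
      using gt_ex lt_ex by blast+
    from interval(1) show ?case
      unfolding open_interval_def
    proof (elim disjE exE)
      assume "I = UNIV"
      then show ?thesis
        using *(1) by blast
    next
      fix a assume "I = {a<..}"
      then show ?thesis
        using *(1)[of a] by auto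
    next
      fix b assume "I = {..<b}"
      then show ?thesis
        using *(2)[of b] by auto
    next
      fix a b assume "I = {a<..<b}"
      then show ?thesis
        using interval(2) by (cases "a < b") auto
    qed
  next
    case (union A B)
    then show ?case by (auto; blast)
  qed auto
qed

lemma infinite_def_setE:
  assumes "def_set S V" "infinite V"
  obtains a b where "a < b" "\<And>y. a < y \<Longrightarrow> y < b \<Longrightarrow> y \<in> V"
  using assms infinite_def_set_iff by blast

lemmas dfb_basic = dfb_not dfb_conj dfb_disj dfb_imp dfb_ex dfb_all dfb_eq dfb_less dfb_le
  var_or_const_var var_or_const_const dfb_const

lemma dfb_finite:
  assumes "dfb S (\<lambda>v. Q (\<lambda>i. v (Suc i)) (v 0))"
  shows "dfb S (\<lambda>v. finite {y. Q v y})"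
proof -
  have iff: "finite {y. Q v y} \<longleftrightarrow> \<not> (\<exists>a b. a < b \<and> (\<forall>y. a < y \<and> y < b \<longrightarrow> Q v y))" for v
    using infinite_def_set_iff[OF dfb_section[OF assms, of v]] by auto
  \<comment> \<open>Under the quantifiers over \<open>a\<close>, \<open>b\<close> and
    \<open>y\<close> the original environment starts at index 3, while \<open>y\<close> sits at
    0.\<close>
  have *: "var_or_const (\<lambda>v. (\<lambda>v i. case i of 0 \<Rightarrow> v 0 | Suc j \<Rightarrow> v (Suc (Suc (Suc j)))) v i)" for i :: nat
    by (cases i) (simp_all add: var_or_const_var)
  have "dfb S (\<lambda>v. Q (\<lambda>i. v (Suc (Suc (Suc i)))) (v 0))"
    using dfb_subst[OF assms, of "\<lambda>v i. case i of 0 \<Rightarrow> v 0 | Suc j \<Rightarrow> v (Suc (Suc (Suc j)))",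
        OF *] by simp
  then show ?thesis
    unfolding iff by (intro dfb_basic)
qed

lemmas dfb_intros = dfb_finite dfb_basic

lemma def_setI: "dfb S (\<lambda>v. P (v 0)) \<Longrightarrow> def_set S {x. P x}"
  by (simp add: def_set_def)

lemma def_rel_section: "def_rel S R \<Longrightarrow> def_set S {y. R x y}"
  by (intro def_setI dfb_intros | erule dfb_rel)+

text \<open>Otherwise the left endpoints of the sections \<open>Z x\<close> would fill an interval; but no left endpoint
  can lie inside another section's interval.\<close>

lemma finite_infinite_sections_of_disjoint:
  assumes Z: "def_rel S Z" and disj: "\<And>x x' y. Z x y \<Longrightarrow> Z x' y \<Longrightarrow> x = x'"
  shows "finite {x. infinite {y. Z x y}}"
proof -
  define L where "L x c \<longleftrightarrow> (\<exists>d>c. \<forall>y. c < y \<and> y < d \<longrightarrow> Z x y)" for x c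
  define E where "E = {c. \<exists>x. L x c \<and> (\<forall>b<c. \<not> (\<forall>y. b < y \<and> y \<le> c \<longrightarrow> Z x y))}"
  have L_unique: "x = x'" if "L x c" "L x' c" for x x' c
  proof -
    from that obtain d d' where "d > c" "\<forall>y. c < y \<and> y < d \<longrightarrow> Z x y"
      "d' > c" "\<forall>y. c < y \<and> y < d' \<longrightarrow> Z x' y"
      unfolding L_def by blast
    moreover obtain m where "c < m" "m < min d d'"
      using \<open>d > c\<close> \<open>d' > c\<close> dense[of c "min d d'"] by auto
    ultimately show ?thesis
      using disj[of x m x'] by simp
  qed
  have "def_set S E"
    unfolding E_def L_def by (intro def_setI dfb_intros dfb_rel[OF Z])
  have "finite E"
  proof (rule ccontr)
    assume "infinite E"
    then obtain p q where pq: "p < q" "\<And>y. p < y \<Longrightarrow> y < q \<Longrightarrow> y \<in> E"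
      using infinite_def_setE[OF \<open>def_set S E\<close>] by blast
    then obtain c where c: "p < c" "c < q"
      using dense by blast
    then obtain x d where d: "d > c" "\<forall>y. c < y \<and> y < d \<longrightarrow> Z x y"
      using pq(2)[of c] unfolding E_def L_def by blast
    then obtain c' where c': "c < c'" "c' < min d q"
      using c dense[of c "min d q"] by auto
    then have "c' \<in> E"
      using pq(2)[of c'] c by auto
    then obtain x' where x': "L x' c'" "\<forall>b<c'. \<not> (\<forall>y. b < y \<and> y \<le> c' \<longrightarrow> Z x' y)"
      unfolding E_def by blast
    have "L x c'"
      unfolding L_def using d c' by (intro exI[of _ d]) auto
    then have "x' = x"
      using x'(1) L_unique by blast
    then show False
      using x'(2) c' d by auto
  qed
  have "finite (\<Union>c\<in>E. {x. L x c})"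
  proof (rule finite_UN_I[OF \<open>finite E\<close>])
    show "finite {x. L x c}" for c
      by (rule finite_Collect_if_unique) (rule L_unique)
  qed
  \<comment> \<open>A section that contains a ray towards minus infinity may have no left endpoint
    in \<open>E\<close>; two such rays meet, so there is at most one such section.\<close>
  moreover have "finite {x. \<exists>d. \<forall>y<d. Z x y}"
  proof -
    have "x = x'" if "\<forall>y<d. Z x y" "\<forall>y<d'. Z x' y" for x x' d d'
    proof -
      obtain y where "y < min d d'"
        using lt_ex by blast
      then show ?thesis
        using that disj[of x y x'] by simp
    qed
    then show ?thesis
      by (intro finite_Collect_if_unique) blast
  qed
  moreover have "{x. infinite {y. Z x y}} \<subseteq> (\<Union>c\<in>E. {x. L x c}) \<union> {x. \<exists>d. \<forall>y<d. Z x y}"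
  proof (rule subsetI, rule ccontr)
    fix x assume "x \<in> {x. infinite {y. Z x y}}"
      and *: "x \<notin> (\<Union>c\<in>E. {x. L x c}) \<union> {x. \<exists>d. \<forall>y<d. Z x y}"
    then have inf: "infinite {y. Z x y}" and unb: "\<nexists>d. \<forall>y<d. Z x y"
      by blast+
    obtain c d where cd: "c < d" "\<And>y. c < y \<Longrightarrow> y < d \<Longrightarrow> Z x y"
      using infinite_def_setE[OF def_rel_section[OF Z] inf] by auto
    \<comment> \<open>Left ends of the intervals that reach \<open>d\<close> inside the section;
      their infimum, which exists by definability, is a point of \<open>E\<close>.\<close>
    let ?P = "{b. b < d \<and> (\<forall>y. b < y \<and> y < d \<longrightarrow> Z x y)}"
    have P: "def_set S ?P"
      by (intro def_setI dfb_intros dfb_rel[OF Z])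
    obtain t where "t < d" "\<not> Z x t"
      using unb by blast
    then have "t \<le> b" if "b \<in> ?P" for b
      using that by (metis (mono_tags, lifting) leI mem_Collect_eq)
    then obtain s where s: "\<And>y. y \<in> ?P \<Longrightarrow> s \<le> y" "\<And>t. s < t \<Longrightarrow> \<exists>y\<in>?P. y < t"
      using def_set_Inf[OF P, of c t] cd by blast
    have "s < d"
      using s(1)[of c] cd by auto
    have sd: "Z x y" if "s < y" "y < d" for y
      using s(2)[of y] that by auto
    have "\<not> (\<forall>y. b < y \<and> y \<le> s \<longrightarrow> Z x y)" if "b < s" for b
    proof
      assume "\<forall>y. b < y \<and> y \<le> s \<longrightarrow> Z x y"
      then have "b \<in> ?P"
        using sd \<open>s < d\<close> that by (auto simp: not_le) (metis not_le)
      then show False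
        using s(1) that by (meson leD)
    qed
    moreover have "L x s"
      unfolding L_def using \<open>s < d\<close> sd by blast
    ultimately have "s \<in> E"
      unfolding E_def by blast
    then show False
      using * \<open>L x s\<close> by blast
  qed
  ultimately show ?thesis
    using finite_subset by blast
qed

end

section \<open>Infinite sections of planar sets\<close>

context o_minimal_structure
begin

lemma def_relI: "dfb S (\<lambda>v. R (v 0) (v (Suc 0))) \<Longrightarrow> def_rel S R"
  by (simp add: def_rel_def)

lemma def_rel_flip:
  assumes "def_rel S R"
  shows "def_rel S (\<lambda>x y. R y x)"
  by (intro def_relI dfb_rel[OF assms] dfb_intros)

lemma finite_def_setI:
  assumes "def_set S V" "\<And>p q. p < q \<Longrightarrow> (\<And>y. p < y \<Longrightarrow> y < q \<Longrightarrow> y \<in> V) \<Longrightarrow> False"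
  shows "finite V"
  using infinite_def_setE[OF assms(1)] assms(2) by blast

text \<open>\<open>G c x\<close> consists of the points of the section over \<open>x\<close> that are new with respect to \<open>]c, x[\<close>.
  Each section has infinitely many new points for some \<open>c < x\<close>, and for fixed \<open>c\<close> the sets \<open>G c x\<close>
  are disjoint. The same idea is then applied to the relation \<open>T\<close>, read from the right.\<close>

lemma no_infinite_sections_on_interval:
  assumes R: "def_rel S R" and "a < b"
    and inf: "\<And>x. a < x \<Longrightarrow> x < b \<Longrightarrow> infinite {y. R x y}"
    and ab: "\<And>x y. R x y \<Longrightarrow> a < x \<and> x < b"
    and fin: "\<And>y. finite {x. R x y}"
  shows False
proof -
  define G where "G c x y \<longleftrightarrow> R x y \<and> \<not> (\<exists>x'. c < x' \<and> x' < x \<and> R x' y)" for c x y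
  have G_mono: "{y. G c x y} \<subseteq> {y. G c' x y}" if "c \<le> c'" for c c' x
    using that by (auto simp: G_def dest: le_less_trans)
  have new: "\<exists>c. a < c \<and> c < x \<and> infinite {y. G c x y}" if x: "a < x" "x < b" for x
  proof (rule ccontr)
    assume "\<not> ?thesis"
    then have finG: "finite {y. G c x y}" if "a < c" "c < x" for c
      using that by blast
    \<comment> \<open>\<open>w\<close> is the last point before \<open>x\<close> whose section also
      contains \<open>y\<close>, so it is determined by \<open>y\<close>.\<close>
    let ?p = "\<lambda>w y. R x y \<and> R w y \<and> w < x \<and> \<not> (\<exists>x'. w < x' \<and> x' < x \<and> R x' y)"
    have "finite {w. \<exists>y. ?p w y}"
    proof (rule finite_def_setI)
      show "def_set S {w. \<exists>y. ?p w y}"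
        by (intro def_setI dfb_intros dfb_rel[OF R])
    next
      fix p q assume "p < q" and pq: "\<And>w. p < w \<Longrightarrow> w < q \<Longrightarrow> w \<in> {w. \<exists>y. ?p w y}"
      \<comment> \<open>If such \<open>w\<close> filled \<open>]p, q[\<close>, distinct ones below
        \<open>m\<close> would come from distinct \<open>y\<close>, all new with respect to
        \<open>]m, x[\<close>, against the finiteness of \<open>G m x\<close>.\<close>
      then obtain m where m: "p < m" "m < q"
        using dense by blast
      have "\<exists>f. \<forall>w. p < w \<and> w < q \<longrightarrow> ?p w (f w)"
        using pq by (intro choice) blast
      then obtain f where f: "\<And>w. p < w \<Longrightarrow> w < q \<Longrightarrow> ?p w (f w)"
        by blast
      have "inj_on f {p<..<m}"
      proof (rule inj_onI)
        fix w w' assume "w \<in> {p<..<m}" "w' \<in> {p<..<m}" and eq: "f w = f w'"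
        then have "p < w" "w < q" "p < w'" "w' < q"
          using m by auto
        then have "?p w (f w)" "?p w' (f w)"
          using f eq by metis+
        then show "w = w'"
          by (metis linorder_cases)
      qed
      moreover have "f ` {p<..<m} \<subseteq> {y. G m x y}"
        using f m by (fastforce simp: G_def)
      moreover have "a < m" "m < x"
        using pq[of m] m ab by auto
      ultimately show False
        using finG[of m] infinite_between[OF \<open>p < m\<close>] inj_on_finite by blast
    qed
    then have fin_im: "finite (insert a {w. \<exists>y. ?p w y})"
      by simp
    then have "Max (insert a {w. \<exists>y. ?p w y}) < x"
      using x by auto
    \<comment> \<open>Beyond all these predecessors, so that every point of the section over
      \<open>x\<close> is new with respect to \<open>]c, x[\<close>.\<close>
    then obtain c where c: "Max (insert a {w. \<exists>y. ?p w y}) < c" "c < x"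
      using dense by blast
    then have c': "w < c" if "?p w y" for w y
      using fin_im that by (auto simp: Max_less_iff simp del: Max_insert)
    have "a < c"
      using c fin_im by (auto simp: Max_less_iff simp del: Max_insert)
    have "{y. R x y} \<subseteq> {y. G c x y}"
    proof (rule subsetI, rule ccontr)
      fix y assume y: "y \<in> {y. R x y}" "y \<notin> {y. G c x y}"
      let ?W = "{w. w < x \<and> R w y}"
      have W: "finite ?W" "\<exists>w\<in>?W. c < w"
        using y fin[of y] by (auto simp: G_def intro: finite_subset)
      then have max: "Max ?W \<in> ?W" "\<And>w. w \<in> ?W \<Longrightarrow> w \<le> Max ?W"
        using Max_in[OF W(1)] Max_ge[OF W(1)] by blast+
      then have "?p (Max ?W) y"
        using y(1) by (auto simp: not_less[symmetric])
      then have "Max ?W < c"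
        by (rule c')
      then show False
        using W(2) max(2) by force
    qed
    then show False
      using inf[OF x] finG[OF \<open>a < c\<close> \<open>c < x\<close>] finite_subset by blast
  qed
  \<comment> \<open>The witness \<open>c0\<close> lies strictly below \<open>c\<close>, so
    \<open>T x c\<close> brings with it \<open>T x c'\<close> for all \<open>c'\<close> in
    \<open>]c0, c[\<close>; this is what makes the sections of \<open>H\<close> infinite.\<close>
  define T where "T x c \<longleftrightarrow> a < x \<and> x < b \<and> c < x \<and> (\<exists>c0. a < c0 \<and> c0 < c \<and> infinite {y. G c0 x y})"
    for x c
  have finT: "finite {x. T x c}" for c
  proof (rule finite_subset)
    show "{x. T x c} \<subseteq> {x. infinite {y. c < x \<and> G c x y}}"
    proof safe
      fix x assume "T x c" "finite {y. c < x \<and> G c x y}"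
      then obtain c0 where "c0 < c" "c < x" "infinite {y. G c0 x y}"
        unfolding T_def by blast
      moreover have "finite {y. G c x y}"
        using \<open>finite {y. c < x \<and> G c x y}\<close> \<open>c < x\<close> by simp
      ultimately show False
        using finite_subset[OF G_mono[OF less_imp_le[OF \<open>c0 < c\<close>], of x]] by blast
    qed
    show "finite {x. infinite {y. c < x \<and> G c x y}}"
    proof (rule finite_infinite_sections_of_disjoint)
      show "def_rel S (\<lambda>x y. c < x \<and> G c x y)"
        unfolding G_def by (intro def_relI dfb_intros dfb_rel[OF R])
      show "x = x'" if "c < x \<and> G c x y" "c < x' \<and> G c x' y" for x x' y
        using that unfolding G_def by (cases x x' rule: linorder_cases) blast+
    qed
  qed
  have T_up: "T x c'" if "T x c" "c \<le> c'" "c' < x" for x c c'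
    using that unfolding T_def by (meson less_le_trans)
  \<comment> \<open>Keeping only the greatest \<open>x\<close> for each \<open>c\<close> makes the
    sections disjoint. Each nonempty one is infinite, so only finitely many \<open>x\<close>
    occur.\<close>
  define H where "H x c \<longleftrightarrow> T x c \<and> \<not> (\<exists>x'. x < x' \<and> T x' c)" for x c
  have "finite {x. infinite {c. H x c}}"
  proof (rule finite_infinite_sections_of_disjoint)
    show "def_rel S H"
      unfolding H_def T_def G_def by (intro def_relI dfb_intros dfb_rel[OF R])
    show "x = x'" if "H x y" "H x' y" for x x' y
      using that unfolding H_def by (metis linorder_cases)
  qed
  moreover have "infinite {c. H x c}" if "H x c" for x c
  proof -
    from that obtain c0 where c0: "c0 < c" "a < c0" "c < x" "infinite {y. G c0 x y}"
      and x: "a < x" "x < b" and *: "\<not> (\<exists>x'. x < x' \<and> T x' c)"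
      unfolding H_def T_def by blast
    have "H x c'" if "c0 < c'" "c' < c" for c'
    proof -
      have "T x c'"
        unfolding T_def using that c0 x by (meson less_trans)
      moreover have "\<not> T x' c'" if "x < x'" for x'
        using * T_up[of x' c' c] that \<open>c' < c\<close> \<open>c < x\<close> by (meson less_imp_le less_trans)
      ultimately show ?thesis
        unfolding H_def by blast
    qed
    then have "{c0<..<c} \<subseteq> {c. H x c}"
      by auto
    then show ?thesis
      using infinite_between[OF \<open>c0 < c\<close>] finite_subset by blast
  qed
  ultimately have finH: "finite {x. \<exists>c. H x c}"
    by (elim finite_subset[rotated]) blast
  \<comment> \<open>For given \<open>c\<close> only finitely many \<open>x\<close> satisfy
    \<open>T x c\<close>, so a greatest one exists. Hence the \<open>x\<close> occurring in
    \<open>H\<close> are cofinal in \<open>]a, b[\<close>, against their finiteness.\<close>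
  have above: "\<exists>x'\<ge>x. \<exists>c. H x' c" if x: "a < x" "x < b" for x
  proof -
    obtain c0 c where "a < c0" "c0 < c" "c < x" "infinite {y. G c0 x y}"
      using new[OF x] dense by meson
    then have "T x c"
      using x unfolding T_def by blast
    then have "Max {x. T x c} \<in> {x. T x c}" "x \<le> Max {x. T x c}"
      using Max_in[OF finT[of c]] Max_ge[OF finT[of c]] by blast+
    moreover have "\<not> T x' c" if "Max {x. T x c} < x'" for x'
      using that finT[of c] by (metis Max_ge mem_Collect_eq not_le)
    ultimately show ?thesis
      unfolding H_def by blast
  qed
  obtain x0 where "a < x0" "x0 < b"
    using dense[OF \<open>a < b\<close>] by blast
  then have "{x. \<exists>c. H x c} \<noteq> {}"
    using above by blast
  then have "Max {x. \<exists>c. H x c} \<in> {x. \<exists>c. H x c}"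
    using finH by (intro Max_in)
  then have "a < Max {x. \<exists>c. H x c}" "Max {x. \<exists>c. H x c} < b"
    unfolding H_def T_def by blast+
  moreover obtain x where "Max {x. \<exists>c. H x c} < x" "x < b"
    using dense[OF calculation(2)] by blast
  ultimately obtain x' c where "x \<le> x'" "H x' c"
    using above[of x] by (meson less_trans)
  then show False
    using finH \<open>Max {x. \<exists>c. H x c} < x\<close> by (metis (mono_tags, lifting) Max_ge leD less_le_trans mem_Collect_eq)
qed

text \<open>Once the finitely many \<open>y\<close> with infinite sections are discarded, infinite
  sections over an interval would coexist with only finite ones in the other direction.\<close>

lemma infinite_infinite_sections_flip:
  assumes R: "def_rel S R" and inf: "infinite {x. infinite {y. R x y}}"
  shows "infinite {y. infinite {x. R x y}}"
proof
  assume B: "finite {y. infinite {x. R x y}}"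
  have "def_set S {x. infinite {y. R x y}}"
    by (intro def_setI dfb_intros dfb_rel[OF R])
  from infinite_def_setE[OF this inf] obtain a b
    where ab: "a < b" "\<And>x. a < x \<Longrightarrow> x < b \<Longrightarrow> infinite {y. R x y}"
    unfolding mem_Collect_eq by metis
  let ?R = "\<lambda>x y. a < x \<and> x < b \<and> R x y \<and> finite {x. R x y}"
  show False
  proof (rule no_infinite_sections_on_interval[OF _ \<open>a < b\<close>])
    show "def_rel S ?R"
      by (intro def_relI dfb_intros dfb_rel[OF R])
    fix x assume x: "a < x" "x < b"
    have "{y. R x y} \<subseteq> {y. ?R x y} \<union> {y. infinite {x. R x y}}"
      using x by auto
    then show "infinite {y. ?R x y}"
      using ab(2)[OF x] B by (meson finite_UnI finite_subset)
  next
    show "finite {x. ?R x y}" for y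
      by (cases "finite {x. R x y}") (auto elim: rev_finite_subset)
  qed auto
qed

text \<open>Asking for one finite projection is enough: the other is then a finite union of finite
  sections, which is why the notion is symmetric under complement.\<close>

definition separated :: "'a set \<Rightarrow> bool" where
  "separated V \<longleftrightarrow> (\<forall>R. def_rel S R \<longrightarrow> (\<forall>x y. R x y \<longrightarrow> x \<notin> V \<and> y \<in> V) \<longrightarrow>
     (\<forall>x. finite {y. R x y}) \<longrightarrow> (\<forall>y. finite {x. R x y}) \<longrightarrow> finite {y. \<exists>x. R x y})"

lemma separatedD:
  assumes "separated V" "def_rel S R" "\<And>x y. R x y \<Longrightarrow> x \<notin> V \<and> y \<in> V"
    "\<And>x. finite {y. R x y}" "\<And>y. finite {x. R x y}"
  shows "finite {y. \<exists>x. R x y}"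
  by (rule assms(1)[unfolded separated_def, rule_format, OF assms(2)]) (fact assms(3-5))+

lemma separated_UNIV: "separated UNIV"
  unfolding separated_def by simp

lemma separated_Compl:
  assumes "separated V"
  shows "separated (- V)"
  unfolding separated_def
proof (intro allI impI)
  fix R assume R: "def_rel S R" "\<forall>x y. R x y \<longrightarrow> x \<notin> - V \<and> y \<in> - V"
    and fin: "\<forall>x. finite {y. R x y}" "\<forall>y. finite {x. R x y}"
  have "finite {x. \<exists>y. R x y}"
    by (rule separatedD[OF assms def_rel_flip[OF R(1)]]) (use R(2) fin in auto)
  moreover have "{y. \<exists>x. R x y} = (\<Union>x\<in>{x. \<exists>y. R x y}. {y. R x y})"
    by auto
  ultimately show "finite {y. \<exists>x. R x y}"
    using fin(1) by simp
qed

lemma separated_Un: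
  assumes "separated V" "separated W" "def_set S V" "def_set S W"
  shows "separated (V \<union> W)"
  unfolding separated_def
proof (intro allI impI)
  fix R assume R: "def_rel S R" "\<forall>x y. R x y \<longrightarrow> x \<notin> V \<union> W \<and> y \<in> V \<union> W"
    and fin: "\<forall>x. finite {y. R x y}" "\<forall>y. finite {x. R x y}"
  have "finite {y. \<exists>x. R x y \<and> y \<in> U}" if U: "separated U" "def_set S U" "U \<subseteq> V \<union> W" for U
  proof (rule separatedD[OF U(1)])
    show "def_rel S (\<lambda>x y. R x y \<and> y \<in> U)"
      by (intro def_relI dfb_intros dfb_rel[OF R(1)] dfb_mem[OF U(2)])
    show "finite {y. R x y \<and> y \<in> U}" for x
      using fin(1) by (rule_tac finite_subset[of _ "{y. R x y}"]) auto
    show "finite {x. R x y \<and> y \<in> U}" for y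
      using fin(2) by (rule_tac finite_subset[of _ "{x. R x y}"]) auto
  qed (use R(2) U(3) in auto)
  then have "finite ({y. \<exists>x. R x y \<and> y \<in> V} \<union> {y. \<exists>x. R x y \<and> y \<in> W})"
    using assms by auto
  moreover have "{y. \<exists>x. R x y} = {y. \<exists>x. R x y \<and> y \<in> V} \<union> {y. \<exists>x. R x y \<and> y \<in> W}"
    using R(2) by blast
  ultimately show "finite {y. \<exists>x. R x y}"
    by (simp only:)
qed

lemma def_set_Compl: "def_set S V \<Longrightarrow> def_set S (- V)"
  using dfb_not unfolding def_set_def by fastforce

lemma def_set_Un: "def_set S V \<Longrightarrow> def_set S W \<Longrightarrow> def_set S (V \<union> W)"
  using dfb_disj unfolding def_set_def by fastforce

text \<open>Symmetry of \<open>V\<close>-dimension at most 0 for planar sets. The \<open>x\<close>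
  in \<open>V\<close> contribute a finite union of finite sets. For the \<open>x\<close> outside
  \<open>V\<close>, few \<open>y\<close> have infinite sections by
  \<open>infinite_infinite_sections_flip\<close>, and the rest is finite-to-finite, where separation
  applies.\<close>

lemma finite_projection_flip:
  assumes V: "separated V" "def_set S V" and R: "def_rel S R"
    and fin: "\<And>x. finite {y \<in> V. R x y}" "finite {x \<in> V. \<exists>y. R x y}"
  shows "finite {y \<in> V. \<exists>x. R x y}"
proof -
  let ?R = "\<lambda>x y. x \<notin> V \<and> y \<in> V \<and> R x y"
  have R': "def_rel S ?R"
    by (intro def_relI dfb_intros dfb_rel[OF R] dfb_mem[OF V(2)])
  have fin': "finite {y. ?R x y}" for x
    using fin(1)[of x] by (rule rev_finite_subset) auto
  have "finite {y. infinite {x. ?R x y}}"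
    using infinite_infinite_sections_flip[OF def_rel_flip[OF R']] fin' by auto
  moreover have "finite {y. \<exists>x. ?R x y \<and> finite {x. ?R x y}}"
  proof (rule separatedD[OF V(1)])
    show "def_rel S (\<lambda>x y. ?R x y \<and> finite {x. ?R x y})"
      by (intro def_relI dfb_intros dfb_rel[OF R] dfb_mem[OF V(2)])
    show "finite {y. ?R x y \<and> finite {x. ?R x y}}" for x
      by (rule finite_subset[OF _ fin'[of x]]) auto
    show "finite {x. ?R x y \<and> finite {x. ?R x y}}" for y
      by (cases "finite {x. ?R x y}") (auto elim: rev_finite_subset)
  qed auto
  moreover have "finite (\<Union>x\<in>{x \<in> V. \<exists>y. R x y}. {y \<in> V. R x y})"
    using fin by simp
  moreover have "{y \<in> V. \<exists>x. R x y} \<subseteq> {y. infinite {x. ?R x y}} \<union>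
      {y. \<exists>x. ?R x y \<and> finite {x. ?R x y}} \<union> (\<Union>x\<in>{x \<in> V. \<exists>y. R x y}. {y \<in> V. R x y})"
    by auto
  ultimately show ?thesis
    by (meson finite_UnI finite_subset)
qed

end

section \<open>The dimension given by a separated set\<close>

lemma definable_setsI: "dfb S P \<Longrightarrow> {xs. length xs = n \<and> P (tuple_env xs)} \<in> definable_sets S n"
  unfolding definable_sets_iff by blast

lemma definable_setsE:
  assumes "X \<in> definable_sets S n"
  obtains P where "dfb S P" "X = {xs. length xs = n \<and> P (tuple_env xs)}"
  using assms unfolding definable_sets_iff by blast

lemma definable_sets_length: "X \<in> definable_sets S n \<Longrightarrow> x \<in> X \<Longrightarrow> length x = n"
  by (auto elim: definable_setsE)

lemma definable_sets_Un:
  assumes "X \<in> definable_sets S n" "Y \<in> definable_sets S n"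
  shows "X \<union> Y \<in> definable_sets S n"
proof -
  obtain P where P: "dfb S P" "X = {xs. length xs = n \<and> P (tuple_env xs)}"
    using assms(1) by (rule definable_setsE)
  obtain Q where Q: "dfb S Q" "Y = {xs. length xs = n \<and> Q (tuple_env xs)}"
    using assms(2) by (rule definable_setsE)
  have "X \<union> Y = {xs. length xs = n \<and> (P (tuple_env xs) \<or> Q (tuple_env xs))}"
    using P(2) Q(2) by auto
  then show ?thesis
    using definable_setsI[OF dfb_disj[OF P(1) Q(1)]] by simp
qed

text \<open>Preimages are definable by renaming variables and compose directly; the image in the
  permutation axiom is the preimage under the inverse permutation.\<close>

definition perm_preimage :: "(nat \<Rightarrow> nat) \<Rightarrow> nat \<Rightarrow> 'a list set \<Rightarrow> 'a list set" where
  "perm_preimage \<sigma> n X = {xs. length xs = n \<and> permute_list \<sigma> xs \<in> X}"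

lemma definable_perm_preimage:
  assumes "X \<in> definable_sets S n" "\<sigma> permutes {..<n}"
  shows "perm_preimage \<sigma> n X \<in> definable_sets S n"
proof -
  obtain P where P: "dfb S P" "X = {xs. length xs = n \<and> P (tuple_env xs)}"
    using assms(1) by (rule definable_setsE)
  have "tuple_env (permute_list \<sigma> xs) = (\<lambda>i. tuple_env xs (\<sigma> i))" if "length xs = n" for xs :: "'a list"
  proof
    fix i
    have "\<sigma> i < n \<longleftrightarrow> i < n"
      using permutes_in_image[OF assms(2)] by (metis lessThan_iff)
    then show "tuple_env (permute_list \<sigma> xs) i = tuple_env xs (\<sigma> i)"
      using that assms(2) by (simp add: tuple_env_def permute_list_nth)
  qed
  then have "perm_preimage \<sigma> n X = {xs. length xs = n \<and> P (\<lambda>i. tuple_env xs (\<sigma> i))}"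
    unfolding perm_preimage_def P(2) by auto
  then show ?thesis
    using definable_setsI[OF dfb_subst[OF P(1), of "\<lambda>v i. v (\<sigma> i)"]]
    by (simp add: var_or_const_var)
qed

lemma permute_list_snoc:
  assumes "\<sigma> permutes {..<length x}"
  shows "permute_list \<sigma> (x @ [y]) = permute_list \<sigma> x @ [y]"
proof (rule nth_equalityI)
  fix i assume "i < length (permute_list \<sigma> (x @ [y]))"
  moreover have "\<sigma> i < length x \<longleftrightarrow> i < length x"
    using permutes_in_image[OF assms] by (metis lessThan_iff)
  moreover have "\<sigma> (length x) = length x"
    using assms by (meson lessThan_iff less_irrefl permutes_not_in)
  ultimately show "permute_list \<sigma> (x @ [y]) ! i = (permute_list \<sigma> x @ [y]) ! i"
    by (auto simp: permute_list_def nth_append less_Suc_eq simp del: upt_Suc)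
qed simp

lemma permute_list_transpose_last:
  "permute_list (transpose (length x) (Suc (length x))) (x @ [y, z]) = x @ [z, y]"
proof (rule nth_equalityI)
  fix i assume "i < length (permute_list (transpose (length x) (Suc (length x))) (x @ [y, z]))"
  then have "i < length x \<or> i = length x \<or> i = Suc (length x)"
    by auto
  then show "permute_list (transpose (length x) (Suc (length x))) (x @ [y, z]) ! i = (x @ [z, y]) ! i"
    by (auto simp: permute_list_def nth_append transpose_def simp del: upt_Suc)
qed simp

definition proj :: "'a list set \<Rightarrow> 'a list set" where
  "proj X = {x. \<exists>y. x @ [y] \<in> X}"

definition inf_proj :: "'a set \<Rightarrow> 'a list set \<Rightarrow> 'a list set" where
  "inf_proj V X = {x. infinite {y \<in> V. x @ [y] \<in> X}}"

text \<open>The value forced by the fibre axiom when a fibre counts as one-dimensional iff it meets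
  \<open>V\<close> in an infinite set. Base points with large fibres may stay in the first term,
  since the shifted second term dominates their contribution. The recursion starts at
  \<open>M^0\<close>, whose only point is \<open>[]\<close>.\<close>

primrec vd :: "'a set \<Rightarrow> nat \<Rightarrow> 'a list set \<Rightarrow> nat option" where
  "vd V 0 X = (if [] \<in> X then Some 0 else None)"
| "vd V (Suc n) X = max (vd V n (proj X)) (shift_dim (vd V n (inf_proj V X)) 1)"

lemma shift_dim_simps [simp]:
  "shift_dim None i = None" "shift_dim (Some k) i = Some (k + i)" "shift_dim d 0 = d"
  "shift_dim (shift_dim d i) j = shift_dim d (i + j)" "shift_dim d i = None \<longleftrightarrow> d = None"
  by (cases d; simp add: shift_dim_def)+

lemma shift_dim_max: "shift_dim (max a b) i = max (shift_dim a i) (shift_dim b i)"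
  by (cases a; cases b) (simp_all add: max_def)

lemma le_shift_dim: "d \<le> shift_dim d i"
  by (cases d) simp_all

lemma max_None [simp]: "max None d = d" "max d None = (d :: nat option)"
  by (simp_all add: max_def) (use less_eq_option_None_is_None in auto)

lemma vd_cong: "(\<And>x. length x = n \<Longrightarrow> x \<in> X \<longleftrightarrow> x \<in> Y) \<Longrightarrow> vd V n X = vd V n Y"
proof (induction n arbitrary: X Y)
  case (Suc n)
  have "vd V n (proj X) = vd V n (proj Y)" "vd V n (inf_proj V X) = vd V n (inf_proj V Y)"
    by (rule Suc.IH; simp add: proj_def inf_proj_def Suc.prems)+
  then show ?case by simp
qed auto

lemma proj_Un: "proj (X \<union> Y) = proj X \<union> proj Y"
  by (auto simp: proj_def)

lemma inf_proj_Un: "inf_proj V (X \<union> Y) = inf_proj V X \<union> inf_proj V Y"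
proof -
  have "{y \<in> V. x @ [y] \<in> X \<union> Y} = {y \<in> V. x @ [y] \<in> X} \<union> {y \<in> V. x @ [y] \<in> Y}" for x
    by auto
  then show ?thesis
    by (simp only: inf_proj_def finite_Un) auto
qed

lemma vd_Un: "vd V n (X \<union> Y) = max (vd V n X) (vd V n Y)"
  by (induction n arbitrary: X Y)
    (simp_all add: proj_Un inf_proj_Un shift_dim_max max.assoc max.left_commute max.commute)

lemma vd_eq_None_iff: "vd V n X = None \<longleftrightarrow> (\<forall>x. length x = n \<longrightarrow> x \<notin> X)"
proof (induction n arbitrary: X)
  case (Suc n)
  have "vd V (Suc n) X = None \<longleftrightarrow> vd V n (proj X) = None \<and> vd V n (inf_proj V X) = None"
    by (cases "vd V n (proj X)"; cases "vd V n (inf_proj V X)") (auto simp: max_def)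
  also have "\<dots> \<longleftrightarrow> (\<forall>x y. length x = n \<longrightarrow> x @ [y] \<notin> X)"
    unfolding Suc by (auto simp: proj_def inf_proj_def)
  also have "\<dots> \<longleftrightarrow> (\<forall>x. length x = Suc n \<longrightarrow> x \<notin> X)"
    by (auto simp: length_Suc_conv_rev)
  finally show ?case .
qed auto

section \<open>Definability of sections, and invariance of \<open>vd\<close> under
  permutations\<close>

context o_minimal_structure
begin

lemma dfb_upd:
  assumes "dfb S P"
  shows "dfb S (\<lambda>v. P ((\<lambda>i. v (Suc i))(n := v 0)))"
proof (rule dfb_subst[OF assms])
  show "var_or_const (\<lambda>v. ((\<lambda>i. v (Suc i))(n := v 0)) i)" for i
    by (cases "i = n") (simp_all add: var_or_const_var)
qed

lemma definable_proj:
  assumes "X \<in> definable_sets S (Suc n)"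
  shows "proj X \<in> definable_sets S n"
proof -
  obtain P where P: "dfb S P" "X = {xs. length xs = Suc n \<and> P (tuple_env xs)}"
    using assms by (rule definable_setsE)
  have "proj X = {xs. length xs = n \<and> (\<exists>y. P ((tuple_env xs)(n := y)))}"
    unfolding P(2) proj_def by (auto simp: tuple_env_snoc)
  then show ?thesis
    using definable_setsI[OF dfb_ex_upd[OF P(1)]] by simp
qed

lemma definable_inf_proj:
  assumes "X \<in> definable_sets S (Suc n)" "def_set S V"
  shows "inf_proj V X \<in> definable_sets S n"
proof -
  obtain P where P: "dfb S P" "X = {xs. length xs = Suc n \<and> P (tuple_env xs)}"
    using assms(1) by (rule definable_setsE)
  have "inf_proj V X = {xs. length xs = n \<and> infinite {y. y \<in> V \<and> P ((tuple_env xs)(n := y))}}"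
  proof (rule set_eqI)
    show "x \<in> inf_proj V X \<longleftrightarrow>
      x \<in> {xs. length xs = n \<and> infinite {y. y \<in> V \<and> P ((tuple_env xs)(n := y))}}" for x
      unfolding P(2) inf_proj_def by (cases "length x = n") (simp_all add: tuple_env_snoc)
  qed
  moreover have "dfb S (\<lambda>v. infinite {y. y \<in> V \<and> P (v(n := y))})"
    by (intro dfb_intros dfb_mem[OF assms(2)] dfb_upd[OF P(1)])
  ultimately show ?thesis
    using definable_setsI by fastforce
qed

lemma definable_section:
  assumes "X \<in> definable_sets S (Suc n)" "length x = n"
  shows "def_set S {y. x @ [y] \<in> X}"
proof -
  obtain P where P: "dfb S P" "X = {xs. length xs = Suc n \<and> P (tuple_env xs)}"
    using assms(1) by (rule definable_setsE)
  have "var_or_const (\<lambda>v. ((tuple_env x)(n := v 0)) i)" for i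
    by (cases "i = n") (simp_all add: var_or_const_var var_or_const_const)
  then have "dfb S (\<lambda>v. P ((tuple_env x)(n := v 0)))"
    by (rule dfb_subst[OF P(1)])
  then show ?thesis
    unfolding P(2) def_set_def by (simp add: assms(2) tuple_env_snoc)
qed

lemma definable_section2:
  assumes "X \<in> definable_sets S (Suc (Suc n))" "length x = n"
  shows "def_rel S (\<lambda>y z. x @ [y, z] \<in> X)"
proof -
  obtain P where P: "dfb S P" "X = {xs. length xs = Suc (Suc n) \<and> P (tuple_env xs)}"
    using assms(1) by (rule definable_setsE)
  have "var_or_const (\<lambda>v. ((tuple_env x)(n := v 0, Suc n := v (Suc 0))) i)" for i
    by (cases "i = n"; cases "i = Suc n") (simp_all add: var_or_const_var var_or_const_const)
  then have *: "dfb S (\<lambda>v. P ((tuple_env x)(n := v 0, Suc n := v (Suc 0))))"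
    by (rule dfb_subst[OF P(1)])
  have "tuple_env (x @ [y, z]) = (tuple_env x)(n := y, Suc n := z)" for y z
    using tuple_env_snoc[of "x @ [y]" z] tuple_env_snoc[of x y] assms(2) by simp
  with * show ?thesis
    unfolding P(2) def_rel_def by (simp add: assms(2))
qed

text \<open>Unfolding the recursion twice, \<open>vd V (n + 2) X\<close> depends only on the sets of points of \<open>M\<^sup>n\<close> whose
  section in \<open>M\<^sup>2\<close> has dimension at least \<open>0\<close>, \<open>1\<close> and \<open>2\<close>.\<close>

lemma vd_Suc_Suc:
  "vd V (Suc (Suc n)) X = max (vd V n {x. \<exists>y z. x @ [y, z] \<in> X})
     (max (shift_dim (vd V n {x. infinite {y \<in> V. \<exists>z. x @ [y, z] \<in> X} \<or> (\<exists>y. infinite {z \<in> V. x @ [y, z] \<in> X})}) 1)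
       (shift_dim (vd V n {x. infinite {y \<in> V. infinite {z \<in> V. x @ [y, z] \<in> X}}}) 2))"
proof -
  have "{x. infinite {y \<in> V. \<exists>z. x @ [y, z] \<in> X} \<or> (\<exists>y. infinite {z \<in> V. x @ [y, z] \<in> X})} =
      inf_proj V (proj X) \<union> proj (inf_proj V X)"
    by (auto simp: proj_def inf_proj_def)
  moreover have "{x. \<exists>y z. x @ [y, z] \<in> X} = proj (proj X)"
    "{x. infinite {y \<in> V. infinite {z \<in> V. x @ [y, z] \<in> X}}} = inf_proj V (inf_proj V X)"
    by (auto simp: proj_def inf_proj_def)
  ultimately show ?thesis
    by (simp add: vd_Un shift_dim_max max.assoc numeral_2_eq_2)
qed

lemma infinite_V_sections_flip:
  assumes "def_rel S R" "def_set S V"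
    and inf: "infinite {y \<in> V. infinite {z \<in> V. R y z}}"
  shows "infinite {z \<in> V. infinite {y \<in> V. R y z}}"
proof -
  let ?R = "\<lambda>y z. y \<in> V \<and> z \<in> V \<and> R y z"
  have "def_rel S ?R"
    by (intro def_relI dfb_intros dfb_rel[OF assms(1)] dfb_mem[OF assms(2)])
  moreover have "infinite {z. ?R y z} \<longleftrightarrow> y \<in> V \<and> infinite {z \<in> V. R y z}" for y
    by (cases "y \<in> V") simp_all
  moreover have "infinite {y. ?R y z} \<longleftrightarrow> z \<in> V \<and> infinite {y \<in> V. R y z}" for z
    by (cases "z \<in> V") simp_all
  ultimately show ?thesis
    using infinite_infinite_sections_flip[of ?R] inf by simp
qed

text \<open>Both disjunctions express that the planar set has \<open>V\<close>-dimension at least 1;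
  this is the level at which swapping the coordinates uses separation.\<close>

lemma section_dim_ge_1_flip:
  assumes "def_rel S R" "def_set S V" "separated V"
    and "infinite {y \<in> V. \<exists>z. R y z} \<or> (\<exists>y. infinite {z \<in> V. R y z})"
  shows "infinite {z \<in> V. \<exists>y. R y z} \<or> (\<exists>z. infinite {y \<in> V. R y z})"
proof (rule ccontr)
  assume "\<not> ?thesis"
  then have fin: "finite {z \<in> V. \<exists>y. R y z}" "\<And>z. finite {y \<in> V. R y z}"
    by auto
  then have "finite {y \<in> V. \<exists>z. R y z}"
    using finite_projection_flip[OF assms(3,2) def_rel_flip[OF assms(1)]] by blast
  moreover have "finite {z \<in> V. R y z}" for y
    by (rule finite_subset[OF _ fin(1)]) auto
  ultimately show False
    using assms(4) by blast
qed

text \<open>By \<open>vd_Suc_Suc\<close> the swap can be checked over each \<open>x\<close>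
  separately: level 0 is clear, level 1 is separation, level 2 is the symmetry of infinitely many
  infinite sections.\<close>

lemma vd_transpose_last:
  assumes X: "X \<in> definable_sets S (Suc (Suc n))" and V: "def_set S V" "separated V"
  shows "vd V (Suc (Suc n)) {xs. permute_list (transpose n (Suc n)) xs \<in> X} = vd V (Suc (Suc n)) X"
proof -
  let ?X = "{xs. permute_list (transpose n (Suc n)) xs \<in> X}"
  have swap: "x @ [y, z] \<in> ?X \<longleftrightarrow> x @ [z, y] \<in> X" if "length x = n" for x y z
    using permute_list_transpose_last[of x y z] that by simp
  have "vd V n {x. \<exists>y z. x @ [y, z] \<in> ?X} = vd V n {x. \<exists>y z. x @ [y, z] \<in> X}"
    by (rule vd_cong) (simp only: mem_Collect_eq[of _ "\<lambda>x. \<exists>y z. x @ [y, z] \<in> _"] swap, blast)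
  moreover have "vd V n {x. infinite {y \<in> V. \<exists>z. x @ [y, z] \<in> ?X} \<or> (\<exists>y. infinite {z \<in> V. x @ [y, z] \<in> ?X})} =
      vd V n {x. infinite {y \<in> V. \<exists>z. x @ [y, z] \<in> X} \<or> (\<exists>y. infinite {z \<in> V. x @ [y, z] \<in> X})}"
  proof (intro vd_cong)
    fix x :: "'a list" assume x: "length x = n"
    show "x \<in> {x. infinite {y \<in> V. \<exists>z. x @ [y, z] \<in> ?X} \<or> (\<exists>y. infinite {z \<in> V. x @ [y, z] \<in> ?X})} \<longleftrightarrow>
      x \<in> {x. infinite {y \<in> V. \<exists>z. x @ [y, z] \<in> X} \<or> (\<exists>y. infinite {z \<in> V. x @ [y, z] \<in> X})}"
      unfolding mem_Collect_eq[of x] swap[OF x]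
      using section_dim_ge_1_flip[OF definable_section2[OF X x] V]
        section_dim_ge_1_flip[OF def_rel_flip[OF definable_section2[OF X x]] V] by blast
  qed
  moreover have "vd V n {x. infinite {y \<in> V. infinite {z \<in> V. x @ [y, z] \<in> ?X}}} =
      vd V n {x. infinite {y \<in> V. infinite {z \<in> V. x @ [y, z] \<in> X}}}"
  proof (intro vd_cong)
    fix x :: "'a list" assume x: "length x = n"
    show "x \<in> {x. infinite {y \<in> V. infinite {z \<in> V. x @ [y, z] \<in> ?X}}} \<longleftrightarrow>
      x \<in> {x. infinite {y \<in> V. infinite {z \<in> V. x @ [y, z] \<in> X}}}"
      unfolding mem_Collect_eq[of x] swap[OF x]
      using infinite_V_sections_flip[OF definable_section2[OF X x] V(1)]
        infinite_V_sections_flip[OF def_rel_flip[OF definable_section2[OF X x]] V(1)] by blast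
  qed
  ultimately show ?thesis
    unfolding vd_Suc_Suc by simp
qed

text \<open>A transposition away from the last coordinate commutes with both projections, so the
  recursion descends until the last two coordinates are exchanged.\<close>

lemma vd_transpose_adjacent:
  assumes V: "def_set S V" "separated V"
  shows "X \<in> definable_sets S n \<Longrightarrow> Suc k < n \<Longrightarrow>
    vd V n {xs. permute_list (transpose k (Suc k)) xs \<in> X} = vd V n X"
proof (induction n arbitrary: X)
  case (Suc n)
  let ?\<tau> = "transpose k (Suc k)"
  show ?case
  proof (cases "Suc k < n")
    case True
    then have "?\<tau> permutes {..<n}"
      by (intro permutes_swap_id) auto
    then have snoc: "permute_list ?\<tau> (x @ [y]) = permute_list ?\<tau> x @ [y]" if "length x = n" for x and y :: 'a
      using that by (intro permute_list_snoc) simp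
    have "vd V n (proj {xs. permute_list ?\<tau> xs \<in> X}) = vd V n {xs. permute_list ?\<tau> xs \<in> proj X}"
      "vd V n (inf_proj V {xs. permute_list ?\<tau> xs \<in> X}) = vd V n {xs. permute_list ?\<tau> xs \<in> inf_proj V X}"
      by (rule vd_cong; simp add: proj_def inf_proj_def snoc)+
    then show ?thesis
      using Suc.IH[OF definable_proj[OF Suc.prems(1)] True]
        Suc.IH[OF definable_inf_proj[OF Suc.prems(1) V(1)] True] by simp
  next
    case False
    then have "n = Suc k"
      using Suc.prems by simp
    then show ?thesis
      using vd_transpose_last[OF _ V] Suc.prems by blast
  qed
qed simp

lemma vd_perm_preimage:
  assumes V: "def_set S V" "separated V" and "\<sigma> permutes {..<n}" "X \<in> definable_sets S n"
  shows "vd V n (perm_preimage \<sigma> n X) = vd V n X"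
proof -
  \<comment> \<open>Here \<open>inv\<close> stands for invariance and hides the inverse
    function.\<close>
  define inv where
    "inv \<sigma> \<longleftrightarrow> \<sigma> permutes {..<n} \<and> (\<forall>X\<in>definable_sets S n. vd V n (perm_preimage \<sigma> n X) = vd V n X)" for \<sigma>
  have comp: "inv (\<sigma> \<circ> \<tau>)" if "inv \<sigma>" "inv \<tau>" for \<sigma> \<tau>
  proof -
    have perm: "\<sigma> permutes {..<n}" "\<tau> permutes {..<n}"
      using that by (auto simp: inv_def)
    have "vd V n (perm_preimage (\<sigma> \<circ> \<tau>) n X) = vd V n X" if X: "X \<in> definable_sets S n" for X
    proof -
      have "perm_preimage (\<sigma> \<circ> \<tau>) n X = perm_preimage \<sigma> n (perm_preimage \<tau> n X)"
        using perm by (auto simp: perm_preimage_def permute_list_compose)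
      then show ?thesis
        using \<open>inv \<sigma>\<close> \<open>inv \<tau>\<close> X definable_perm_preimage[OF X perm(2)] by (simp add: inv_def)
    qed
    then show ?thesis
      unfolding inv_def using perm permutes_compose by blast
  qed
  have adjacent: "inv (transpose k (Suc k))" if "Suc k < n" for k
  proof -
    have "vd V n (perm_preimage (transpose k (Suc k)) n X) = vd V n X" if "X \<in> definable_sets S n" for X
      using vd_transpose_adjacent[OF V that \<open>Suc k < n\<close>]
        vd_cong[of n "perm_preimage (transpose k (Suc k)) n X" "{xs. permute_list (transpose k (Suc k)) xs \<in> X}"]
      by (simp add: perm_preimage_def)
    moreover have "transpose k (Suc k) permutes {..<n}"
      using that by (intro permutes_swap_id) auto
    ultimately show ?thesis
      by (simp add: inv_def)
  qed
  have less: "inv (transpose a (a + Suc d))" if "a + Suc d < n" for a d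
    using that
  proof (induction d)
    case (Suc d)
    let ?\<tau> = "transpose (a + Suc d) (Suc (a + Suc d))" and ?\<sigma> = "transpose a (a + Suc d)"
    \<comment> \<open>Conjugation by an adjacent transposition increases the distance of the
      exchanged coordinates by one, so every transposition is reached.\<close>
    have "?\<tau> \<circ> ?\<sigma> \<circ> ?\<tau> = transpose a (a + Suc (Suc d))"
      using transpose_comp_triple[of "Suc (a + Suc d)" a "a + Suc d"]
      by (simp add: transpose_commute[of "Suc (Suc (a + d))"] transpose_commute[of "Suc (a + d)" a])
    moreover have "inv ?\<tau>" "inv ?\<sigma>"
      using Suc adjacent[of "a + Suc d"] by simp_all
    ultimately show ?case
      using comp by metis
  qed (use adjacent in simp)
  have "inv id"
    by (auto simp: inv_def perm_preimage_def permutes_id intro!: vd_cong)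
  have any: "inv (transpose a b)" if "a < n" "b < n" for a b
  proof (cases a b rule: linorder_cases)
    case less
    then show ?thesis
      using \<open>\<And>a d. a + Suc d < n \<Longrightarrow> inv (transpose a (a + Suc d))\<close>[of a "b - a - 1"] that by simp
  next
    case equal
    then show ?thesis
      using \<open>inv id\<close> by simp
  next
    case greater
    then show ?thesis
      using less[of b "a - b - 1"] that by (simp add: transpose_commute)
  qed
  have "inv \<sigma>"
    using assms(3) finite_lessThan
  proof (induction rule: permutes_induct)
    case (swap a b p)
    then show ?case by (intro comp any) auto
  qed (fact \<open>inv id\<close>)
  then show ?thesis
    using assms(4) by (simp add: inv_def)
qed

end

section \<open>The axioms of a dimension function for \<open>vd\<close>\<close>

abbreviation points :: "'a set \<Rightarrow> 'a list set" where
  "points Y \<equiv> (\<lambda>y. [y]) ` Y"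

lemma fibre_eq_points: "fibre X x = points {y. x @ [y] \<in> X}"
  by (auto simp: fibre_def)

lemma points_length_1: "points UNIV = {xs. length xs = 1}"
  by (auto simp: length_Suc_conv)

lemma vd_points:
  "vd V (Suc 0) (points Y) = (if Y = {} then None else if finite (V \<inter> Y) then Some 0 else Some 1)"
proof -
  have "{y \<in> V. [y] \<in> points Y} = V \<inter> Y"
    by auto
  then show ?thesis
    by (auto simp: proj_def inf_proj_def)
qed

lemma definable_sets_Diff:
  assumes "X \<in> definable_sets S n" "Y \<in> definable_sets S n"
  shows "X - Y \<in> definable_sets S n"
proof -
  obtain P where P: "dfb S P" "X = {xs. length xs = n \<and> P (tuple_env xs)}"
    using assms(1) by (rule definable_setsE)
  obtain Q where Q: "dfb S Q" "Y = {xs. length xs = n \<and> Q (tuple_env xs)}"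
    using assms(2) by (rule definable_setsE)
  have "X - Y = {xs. length xs = n \<and> (P (tuple_env xs) \<and> \<not> Q (tuple_env xs))}"
    using P(2) Q(2) by auto
  then show ?thesis
    using definable_setsI[OF dfb_conj[OF P(1) dfb_not[OF Q(1)]]] by simp
qed

lemma definable_butlast_vimage:
  assumes "X \<in> definable_sets S (Suc n)" "F \<in> definable_sets S n"
  shows "{x \<in> X. butlast x \<in> F} \<in> definable_sets S (Suc n)"
proof -
  obtain P where P: "dfb S P" "X = {xs. length xs = Suc n \<and> P (tuple_env xs)}"
    using assms(1) by (rule definable_setsE)
  obtain Q where Q: "dfb S Q" "F = {xs. length xs = n \<and> Q (tuple_env xs)}"
    using assms(2) by (rule definable_setsE)
  have "var_or_const (\<lambda>v. (v(n := undefined)) i)" for i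
    by (cases "i = n") (simp_all add: var_or_const_var var_or_const_const)
  then have *: "dfb S (\<lambda>v. Q (v(n := undefined)))"
    by (rule dfb_subst[OF Q(1)])
  have "tuple_env (butlast xs) = (tuple_env xs)(n := undefined)" if "length xs = Suc n" for xs :: "'a list"
    using that by (auto simp: tuple_env_def nth_butlast fun_eq_iff)
  then have "{x \<in> X. butlast x \<in> F} =
      {xs. length xs = Suc n \<and> (P (tuple_env xs) \<and> Q ((tuple_env xs)(n := undefined)))}"
    using P(2) Q(2) by auto
  then show ?thesis
    using definable_setsI[OF dfb_conj[OF P(1) *]] by simp
qed

lemma definable_points_iff: "points Y \<in> definable_sets S (Suc 0) \<longleftrightarrow> def_set S Y"
proof
  assume "def_set S Y"
  moreover have "points Y = {xs. length xs = Suc 0 \<and> tuple_env xs 0 \<in> Y}"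
    by (auto simp: tuple_env_def length_Suc_conv)
  ultimately show "points Y \<in> definable_sets S (Suc 0)"
    unfolding def_set_def using definable_setsI[of S "\<lambda>v. v 0 \<in> Y"] by simp
next
  assume "points Y \<in> definable_sets S (Suc 0)"
  then obtain P where P: "dfb S P" "points Y = {xs. length xs = Suc 0 \<and> P (tuple_env xs)}"
    by (rule definable_setsE)
  have "var_or_const (\<lambda>v. ((tuple_env [])(0 := v 0)) i)" for i
    by (cases "i = 0") (simp_all add: var_or_const_var var_or_const_const)
  then have "dfb S (\<lambda>v. P ((tuple_env [])(0 := v 0)))"
    by (rule dfb_subst[OF P(1)])
  moreover have "y \<in> Y \<longleftrightarrow> P ((tuple_env [])(0 := y))" for y
    using arg_cong[OF P(2), of "\<lambda>Z. [y] \<in> Z"] tuple_env_snoc[of "[]" y] by auto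
  ultimately show "def_set S Y"
    by (simp add: def_set_def)
qed

lemma definable_pairs:
  assumes "def_rel S R"
  shows "{[x, y] | x y. R x y} \<in> definable_sets S (Suc (Suc 0))"
proof -
  have "{[x, y] | x y. R x y} = {xs. length xs = Suc (Suc 0) \<and> R (tuple_env xs 0) (tuple_env xs (Suc 0))}"
    by (auto simp: tuple_env_def length_Suc_conv)
  then show ?thesis
    using definable_setsI[OF assms[unfolded def_rel_def]] by simp
qed

lemma definable_set_1E:
  assumes "X \<in> definable_sets S (Suc 0)"
  obtains Y where "X = points Y" "def_set S Y"
proof -
  have "X = points {y. [y] \<in> X}"
    using definable_sets_length[OF assms] by (fastforce simp: length_Suc_conv image_iff)
  then show thesis
    using that assms definable_points_iff by metis
qed

lemma fibre_dim_set_cong: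
  assumes "\<And>Y. Y \<in> definable_sets S (Suc 0) \<Longrightarrow> d Y = d' Y" "X \<in> definable_sets S (Suc n)"
    "\<And>x. x \<in> butlast ` X \<Longrightarrow> fibre X x \<in> definable_sets S (Suc 0)"
  shows "fibre_dim_set d X i = fibre_dim_set d' X i"
  using assms unfolding fibre_dim_set_def by auto

lemma butlast_image_eq_proj:
  assumes "X \<in> definable_sets S (Suc n)"
  shows "butlast ` X = proj X"
proof -
  have "x \<noteq> []" if "x \<in> X" for x
    using definable_sets_length[OF assms that] by auto
  then have "\<exists>y. butlast x @ [y] \<in> X" if "x \<in> X" for x
    using that by (intro exI[of _ "last x"]) simp
  then show ?thesis
    by (force simp: proj_def image_iff)
qed

context o_minimal_structure
begin

lemma definable_fibre:
  assumes "X \<in> definable_sets S (Suc n)" "x \<in> butlast ` X"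
  shows "fibre X x \<in> definable_sets S (Suc 0)"
proof -
  have "length x = n"
    using assms definable_sets_length by fastforce
  then show ?thesis
    unfolding fibre_eq_points definable_points_iff by (rule definable_section[OF assms(1)])
qed

lemma permute_image_eq_perm_preimage:
  assumes "X \<in> definable_sets S n" "\<sigma> permutes {..<n}"
  shows "permute_list \<sigma> ` X = perm_preimage (inv \<sigma>) n X"
proof -
  have inv: "inv \<sigma> permutes {..<n}"
    using assms(2) by (rule permutes_inv)
  have "permute_list (inv \<sigma>) (permute_list \<sigma> xs) = xs" "permute_list \<sigma> (permute_list (inv \<sigma>) xs) = xs"
    if "length xs = n" for xs :: "'a list"
    using that assms(2) inv permute_list_compose[of "inv \<sigma>" xs \<sigma>] permute_list_compose[of \<sigma> xs "inv \<sigma>"]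
    by (simp_all add: permutes_inv_o)
  then show ?thesis
    using definable_sets_length[OF assms(1)] unfolding perm_preimage_def image_def
    by (auto; metis length_permute_list)
qed

lemma def_set_const: "def_set S UNIV" "def_set S {}"
  by (simp_all add: def_set_def dfb_const)

lemma def_set_singleton: "def_set S {a}"
  unfolding def_set_def singleton_iff by (intro dfb_intros)

lemma def_set_Int: "def_set S A \<Longrightarrow> def_set S B \<Longrightarrow> def_set S (A \<inter> B)"
  unfolding def_set_def Int_iff by (rule dfb_conj)

lemma def_set_finite: "finite A \<Longrightarrow> def_set S A"
  by (induction A rule: finite_induct)
    (simp_all add: def_set_const, metis def_set_Un def_set_singleton insert_is_Un)

lemma def_set_interval: "def_set S {a<..<b}"
  unfolding def_set_def greaterThanLessThan_iff by (intro dfb_intros)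

lemma def_set_open_interval:
  assumes "open_interval J"
  shows "def_set S J"
proof -
  have "def_set S {a<..}" "def_set S {..<b}" for a b
    unfolding def_set_def greaterThan_iff lessThan_iff by (intro dfb_intros)+
  then show ?thesis
    using assms def_set_const(1) def_set_interval unfolding open_interval_def by auto
qed

text \<open>\<open>vd\<close> takes the number of coordinates as an argument and a dimension
  function does not, hence the formulation for any \<open>e\<close> that agrees with
  \<open>vd V n\<close> in each \<open>M^n\<close>. Infinitude of \<open>V\<close> gives the line
  dimension 1.\<close>

lemma dimension_function_vd:
  assumes V: "def_set S V" "separated V" "infinite V"
    and e: "\<And>n X. n > 0 \<Longrightarrow> X \<in> definable_sets S n \<Longrightarrow> e X = vd V n X"
  shows "dimension_function S e"
proof -
  have e_points: "e (points Y) = (if Y = {} then None else if finite (V \<inter> Y) then Some 0 else Some 1)"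
    if "def_set S Y" for Y
    using e[of "Suc 0" "points Y"] that vd_points[of V Y] by (simp add: definable_points_iff)
  have "e {} = None"
    using e_points[OF def_set_const(2)] by simp
  moreover have "e {[a]} = Some 0" for a
    using e_points[OF def_set_singleton[of a]] by simp
  moreover have "e {xs. length xs = 1} = Some 1"
    using e_points[OF def_set_const(1)] V(3) unfolding points_length_1 by simp
  moreover have "e (X \<union> Y) = max (e X) (e Y)"
    if "n > 0" "X \<in> definable_sets S n" "Y \<in> definable_sets S n" for n X Y
    using e[OF that(1,2)] e[OF that(1,3)] e[OF that(1) definable_sets_Un[OF that(2,3)]]
    by (simp add: vd_Un)
  moreover have "e (permute_list \<sigma> ` X) = e X"
    if "n > 0" "X \<in> definable_sets S n" "\<sigma> permutes {..<n}" for n X \<sigma>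
    using that definable_perm_preimage[OF that(2) permutes_inv[OF that(3)]]
      vd_perm_preimage[OF V(1,2) permutes_inv[OF that(3)] that(2)]
    by (simp add: permute_image_eq_perm_preimage e)
  moreover have "fibre_dim_set e X i \<in> definable_sets S (n - 1) \<and>
      e {x \<in> X. butlast x \<in> fibre_dim_set e X i} = shift_dim (e (fibre_dim_set e X i)) i"
    if n: "n > 1" and X: "X \<in> definable_sets S n" and i: "i \<in> {0, 1}" for n X i
  proof -
    obtain m where m: "n = Suc m" "m > 0"
      using n by (cases n) auto
    note X' = X[unfolded m(1)]
    let ?F = "fibre_dim_set e X"
    have e_fibre: "e (fibre X x) = (if finite {y \<in> V. x @ [y] \<in> X} then Some 0 else Some 1)"
      if "x \<in> proj X" for x
    proof -
      have "def_set S {y. x @ [y] \<in> X}"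
        using definable_fibre[OF X'] that
        by (simp add: butlast_image_eq_proj[OF X'] fibre_eq_points definable_points_iff)
      moreover have "V \<inter> {y. x @ [y] \<in> X} = {y \<in> V. x @ [y] \<in> X}" "{y. x @ [y] \<in> X} \<noteq> {}"
        using that by (auto simp: proj_def)
      ultimately show ?thesis
        unfolding fibre_eq_points by (simp add: e_points)
    qed
    have inf_proj: "inf_proj V X \<subseteq> proj X"
      by (auto simp: inf_proj_def proj_def intro: ccontr)
    have F1: "?F 1 = inf_proj V X"
      using e_fibre inf_proj unfolding fibre_dim_set_def butlast_image_eq_proj[OF X']
      by (auto simp: inf_proj_def split: if_splits)
    have F0: "?F 0 = proj X - inf_proj V X"
      using e_fibre inf_proj unfolding fibre_dim_set_def butlast_image_eq_proj[OF X']
      by (auto simp: inf_proj_def split: if_splits)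
    have defF: "?F i \<in> definable_sets S m"
      using i F0 F1 definable_inf_proj[OF X' V(1)] definable_proj[OF X'] definable_sets_Diff by auto
    let ?X = "{x \<in> X. butlast x \<in> ?F i}"
    have "e ?X = vd V (Suc m) ?X"
      using e[of "Suc m"] definable_butlast_vimage[OF X' defF] by simp
    \<comment> \<open>Over \<open>X(0)\<close> no fibre is large, so the second term of the
      recursion is \<open>None\<close>. Over \<open>X(1)\<close> both projections coincide and the
      shifted term is the maximum.\<close>
    also have "\<dots> = shift_dim (vd V m (?F i)) i"
    proof (cases "i = 0")
      case True
      have "proj ?X = ?F 0"
        using True F0 by (auto simp: proj_def)
      moreover have "inf_proj V ?X = {}"
        unfolding True F0 inf_proj_def
      proof (intro equals0I, unfold mem_Collect_eq)
        fix x
        assume inf: "infinite {y \<in> V. x @ [y] \<in> X \<and>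
            butlast (x @ [y]) \<in> proj X - {x. infinite {y \<in> V. x @ [y] \<in> X}}}"
        then have fin: "finite {y \<in> V. x @ [y] \<in> X}"
          using not_finite_existsD by fastforce
        show False
          by (rule notE[OF inf rev_finite_subset[OF fin]]) blast
      qed
      moreover have "vd V m {} = None"
        by (simp add: vd_eq_None_iff)
      ultimately show ?thesis
        using True by simp
    next
      case False
      then have "i = 1"
        using i by simp
      have "proj ?X = ?F 1"
        unfolding \<open>i = 1\<close> F1 using inf_proj by (auto simp: proj_def)
      moreover have "inf_proj V ?X = ?F 1"
        unfolding \<open>i = 1\<close> F1 by (auto simp: inf_proj_def)
      ultimately show ?thesis
        using \<open>i = 1\<close> le_shift_dim[of "vd V m (?F 1)" 1] by (simp add: max_absorb2)
    qed
    also have "\<dots> = shift_dim (e (?F i)) i"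
      using e[OF m(2) defF] by simp
    finally show ?thesis
      using defF m(1) by simp
  qed
  ultimately show ?thesis
    unfolding dimension_function_def by blast
qed

end

section \<open>The separated set of a dimension function\<close>

locale dimension_on_o_minimal = o_minimal_structure +
  fixes d :: "'a list set \<Rightarrow> nat option"
  assumes dim: "dimension_function S d"
begin

definition \<delta> :: "'a set \<Rightarrow> nat option" where
  "\<delta> Y = d (points Y)"

lemma dim_Un: "n > 0 \<Longrightarrow> X \<in> definable_sets S n \<Longrightarrow> Y \<in> definable_sets S n \<Longrightarrow> d (X \<union> Y) = max (d X) (d Y)"
  using dim unfolding dimension_function_def by blast

lemma dim_permute: "n > 0 \<Longrightarrow> X \<in> definable_sets S n \<Longrightarrow> \<sigma> permutes {..<n} \<Longrightarrow> d (permute_list \<sigma> ` X) = d X"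
  using dim unfolding dimension_function_def by blast

lemma dim_fibre:
  assumes "n > 1" "X \<in> definable_sets S n" "i \<in> {0, 1}"
  shows "fibre_dim_set d X i \<in> definable_sets S (n - 1)"
    "d {x \<in> X. butlast x \<in> fibre_dim_set d X i} = shift_dim (d (fibre_dim_set d X i)) i"
  using dim assms unfolding dimension_function_def by blast+

lemma \<delta>_basic: "\<delta> {} = None" "\<delta> {a} = Some 0" "\<delta> UNIV = Some 1"
  using dim unfolding \<delta>_def points_length_1 by (simp_all add: dimension_function_def)

lemma \<delta>_Un: "def_set S A \<Longrightarrow> def_set S B \<Longrightarrow> \<delta> (A \<union> B) = max (\<delta> A) (\<delta> B)"
  using dim_Un[of "Suc 0" "points A" "points B"] by (simp add: \<delta>_def definable_points_iff image_Un)

lemma \<delta>_mono: "def_set S A \<Longrightarrow> def_set S B \<Longrightarrow> A \<subseteq> B \<Longrightarrow> \<delta> A \<le> \<delta> B"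
  using \<delta>_Un[of A B] by (metis Un_absorb1 max.cobounded1)

lemma \<delta>_values:
  assumes "def_set S A" "A \<noteq> {}"
  shows "\<delta> A = Some 0 \<or> \<delta> A = Some 1"
proof -
  obtain a where "{a} \<subseteq> A"
    using assms(2) by blast
  then have "Some 0 \<le> \<delta> A" "\<delta> A \<le> Some 1"
    using \<delta>_mono[OF def_set_singleton assms(1)] \<delta>_mono[OF assms(1) def_set_const(1)]
    by (simp_all add: \<delta>_basic)
  then show ?thesis
    by (cases "\<delta> A") auto
qed

lemma \<delta>_le_0_iff: "def_set S A \<Longrightarrow> \<delta> A \<le> Some 0 \<longleftrightarrow> \<delta> A \<noteq> Some 1"
  using \<delta>_values[of A] by (cases "A = {}") (auto simp: \<delta>_basic)

lemma \<delta>_le_0_Un: "def_set S A \<Longrightarrow> def_set S B \<Longrightarrow> \<delta> A \<le> Some 0 \<Longrightarrow> \<delta> B \<le> Some 0 \<Longrightarrow> \<delta> (A \<union> B) \<le> Some 0"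
  by (simp add: \<delta>_Un)

lemma \<delta>_le_0_subset: "def_set S A \<Longrightarrow> def_set S B \<Longrightarrow> A \<subseteq> B \<Longrightarrow> \<delta> B \<le> Some 0 \<Longrightarrow> \<delta> A \<le> Some 0"
  using \<delta>_mono by (meson order_trans)

lemma \<delta>_finite:
  assumes "finite A"
  shows "\<delta> A \<le> Some 0"
  using assms
proof (induction A rule: finite_induct)
  case (insert x A)
  then show ?case
    using \<delta>_le_0_Un[OF def_set_singleton def_set_finite, of A x] by (simp add: \<delta>_basic)
qed (simp add: \<delta>_basic)

lemma \<delta>_finite_nonempty: "finite A \<Longrightarrow> A \<noteq> {} \<Longrightarrow> \<delta> A = Some 0"
  using \<delta>_finite[of A] \<delta>_values[OF def_set_finite, of A] by auto

text \<open>Constant fibre dimension makes \<open>fibre_dim_set\<close> the whole projection, so the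
  fibre axiom computes the dimension outright.\<close>

lemma dim_pairs:
  assumes "def_rel S R" "i \<in> {0, 1}" "\<And>x y. R x y \<Longrightarrow> \<delta> {y. R x y} = Some i"
  shows "d {[x, y] | x y. R x y} = shift_dim (\<delta> {x. \<exists>y. R x y}) i"
proof -
  let ?X = "{[x, y] | x y. R x y}"
  have "butlast ` ?X = points {x. \<exists>y. R x y}"
    by (force simp: image_iff)
  moreover have "fibre ?X [x] = points {y. R x y}" for x
    by (auto simp: fibre_def)
  ultimately have "fibre_dim_set d ?X i = points {x. \<exists>y. R x y}"
    unfolding fibre_dim_set_def using assms(3)[unfolded \<delta>_def] by auto
  moreover from this have "{x \<in> ?X. butlast x \<in> fibre_dim_set d ?X i} = ?X"
    by auto
  ultimately show ?thesis
    using dim_fibre(2)[OF _ definable_pairs[OF assms(1)] assms(2)] by (simp add: \<delta>_def)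
qed

lemma dim_pairs_flip:
  assumes "def_rel S R"
  shows "d {[y, x] | x y. R x y} = d {[x, y] | x y. R x y}"
proof -
  have "permute_list (transpose 0 (Suc 0)) [x, y] = [y, x]" for x y :: 'a
    using permute_list_transpose_last[of "[]" x y] by simp
  then have "permute_list (transpose 0 (Suc 0)) ` {[x, y] | x y. R x y} = {[y, x] | x y. R x y}"
    by (force simp: image_iff)
  moreover have "transpose 0 (Suc 0) permutes {..<Suc (Suc 0)}"
    by (intro permutes_swap_id) auto
  ultimately show ?thesis
    using dim_permute[OF _ definable_pairs[OF assms]] by fastforce
qed

text \<open>Both sides are the dimension of the same planar set, fibred over either coordinate and
  compared by the permutation axiom.\<close>

lemma fubini:
  assumes R: "def_rel S R" and "i \<in> {0, 1}" "\<And>x y. R x y \<Longrightarrow> \<delta> {y. R x y} = Some i"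
    and "j \<in> {0, 1}" "\<And>x y. R x y \<Longrightarrow> \<delta> {x. R x y} = Some j"
  shows "shift_dim (\<delta> {x. \<exists>y. R x y}) i = shift_dim (\<delta> {y. \<exists>x. R x y}) j"
proof -
  have "{[x, y] | x y. R y x} = {[y, x] | x y. R x y}"
    by blast
  then show ?thesis
    using dim_pairs[OF assms(1-3)] dim_pairs[OF def_rel_flip[OF R] assms(4,5)] dim_pairs_flip[OF R]
    by simp
qed

text \<open>Otherwise the triangle \<open>{(y, u) \<in> K\<^sup>2. r y u}\<close> would have dimension at most \<open>1\<close> when fibred over \<open>y\<close>
  and dimension \<open>2\<close> when fibred over \<open>u\<close>.\<close>

lemma \<delta>_le_0_if_tails_le_0:
  assumes K: "def_set S K" and r: "def_rel S r" "\<And>x y. x \<noteq> y \<Longrightarrow> r x y \<or> r y x"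
    and tail: "\<And>y. y \<in> K \<Longrightarrow> \<delta> {u \<in> K. r y u} \<le> Some 0"
  shows "\<delta> K \<le> Some 0"
proof (rule ccontr)
  assume "\<not> \<delta> K \<le> Some 0"
  then have K1: "\<delta> K = Some 1"
    using \<delta>_le_0_iff[OF K] by blast
  let ?R = "\<lambda>y u. y \<in> K \<and> u \<in> K \<and> r y u"
  have R: "def_rel S ?R"
    by (intro def_relI dfb_intros dfb_mem[OF K] dfb_rel[OF r(1)])
  have def1: "def_set S {u \<in> K. r y u}" and def2: "def_set S {u \<in> K. r u y}" for y
    by (intro def_setI dfb_intros dfb_mem[OF K] dfb_rel[OF r(1)])+
  \<comment> \<open>Otherwise \<open>K\<close> would be covered by a head, a point and a tail, all
    of dimension at most 0.\<close>
  have head: "\<delta> {y \<in> K. r y u} = Some 1" if "u \<in> K" for u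
  proof (rule ccontr)
    assume "\<delta> {y \<in> K. r y u} \<noteq> Some 1"
    then have "\<delta> {y \<in> K. r y u} \<le> Some 0"
      using \<delta>_le_0_iff[OF def2] by blast
    then have le: "\<delta> ({y \<in> K. r y u} \<union> ({u} \<union> {y \<in> K. r u y})) \<le> Some 0"
      using tail[OF that]
      by (intro \<delta>_le_0_Un def1 def2 def_set_Un def_set_singleton) (simp_all add: \<delta>_basic)
    have sub: "K \<subseteq> {y \<in> K. r y u} \<union> ({u} \<union> {y \<in> K. r u y})"
      using r(2) by blast
    have "\<delta> K \<le> Some 0"
      by (rule \<delta>_le_0_subset[OF K _ sub le]) (intro def1 def2 def_set_Un def_set_singleton)
    then show False
      using K1 by simp
  qed
  have "\<exists>y. ?R y u" if "u \<in> K" for u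
    using head[OF that] that \<delta>_basic(1) by (metis (mono_tags, lifting) Collect_empty_eq option.distinct(1))
  then have proj2: "{u. \<exists>y. ?R y u} = K"
    by blast
  have "shift_dim (\<delta> {y. \<exists>u. ?R y u}) 0 = shift_dim (\<delta> {u. \<exists>y. ?R y u}) 1"
  proof (rule fubini[OF R])
    fix y u assume "?R y u"
    then have "{u. ?R y u} = {u \<in> K. r y u}" "{u \<in> K. r y u} \<noteq> {}" "{y. ?R y u} = {y \<in> K. r y u}"
      by auto
    then show "\<delta> {u. ?R y u} = Some 0" "\<delta> {y. ?R y u} = Some 1"
      using \<delta>_values[OF def1, of y] tail[of y] head[of u] \<open>?R y u\<close> by auto
  qed auto
  \<comment> \<open>Large fibres over the one-dimensional base \<open>K\<close> give the triangle
    dimension 2, while its small fibres over \<open>y\<close> pass this value on to a subset of the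
    line, which is impossible.\<close>
  then have "\<delta> {y. \<exists>u. ?R y u} = Some 2"
    unfolding proj2 K1 by simp
  moreover have "def_set S {y. \<exists>u. ?R y u}"
    by (intro def_setI dfb_intros dfb_mem[OF K] dfb_rel[OF r(1)])
  moreover have "\<delta> A \<noteq> Some 2" if "def_set S A" for A
    using \<delta>_values[OF that] \<delta>_basic(1) by (cases "A = {}") auto
  ultimately show False
    by blast
qed

section \<open>The set \<open>W\<close> and negligible subsets of the line\<close>

definition W :: "'a set" where
  "W = {x. \<forall>b<x. \<delta> {b<..<x} = Some 1}"

text \<open>Dimension is definable in families by the definability half of the fibre axiom, applied
  to triples whose fibre over \<open>[x, b]\<close> is \<open>]b, x[\<close>.\<close>

lemma def_rel_small_interval: "def_rel S (\<lambda>x b. b < x \<and> \<delta> {b<..<x} = Some 1)"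
proof -
  let ?X = "{[x, b, y] | x b y :: 'a. b < y \<and> y < x}"
  have eq: "?X = {xs. length xs = Suc (Suc (Suc 0)) \<and> (tuple_env xs (Suc 0) < tuple_env xs (Suc (Suc 0)) \<and>
      tuple_env xs (Suc (Suc 0)) < tuple_env xs 0)}"
    by (auto simp: tuple_env_def length_Suc_conv)
  have "dfb S (\<lambda>v. v (Suc 0) < v (Suc (Suc 0)) \<and> v (Suc (Suc 0)) < v 0)"
    by (intro dfb_intros)
  then have "?X \<in> definable_sets S (Suc (Suc (Suc 0)))"
    unfolding eq by (rule definable_setsI)
  then have "fibre_dim_set d ?X 1 \<in> definable_sets S (Suc (Suc 0))"
    using dim_fibre(1)[of "Suc (Suc (Suc 0))" ?X 1] by simp
  then have "def_rel S (\<lambda>x b. [] @ [x, b] \<in> fibre_dim_set d ?X 1)"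
    by (rule definable_section2) simp
  moreover have "[x, b] \<in> fibre_dim_set d ?X 1 \<longleftrightarrow> b < x \<and> \<delta> {b<..<x} = Some 1" for x b
  proof -
    have "[x, b] \<in> butlast ` ?X \<longleftrightarrow> (\<exists>y. b < y \<and> y < x)"
      by (force simp: image_iff)
    also have "\<dots> \<longleftrightarrow> b < x"
      using dense by (meson less_trans)
    finally have "[x, b] \<in> butlast ` ?X \<longleftrightarrow> b < x" .
    moreover have "fibre ?X [x, b] = points {b<..<x}"
      by (auto simp: fibre_def)
    ultimately show ?thesis
      by (simp add: fibre_dim_set_def \<delta>_def)
  qed
  ultimately show ?thesis
    by simp
qed

lemma def_set_W: "def_set S W"
proof -
  have "W = {x. \<forall>b. b < x \<longrightarrow> (b < x \<and> \<delta> {b<..<x} = Some 1)}"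
    unfolding W_def by auto
  also have "def_set S \<dots>"
    by (intro def_setI dfb_all dfb_imp dfb_rel[OF def_rel_small_interval] dfb_less var_or_const_var)
  finally show ?thesis .
qed

lemma not_in_W_iff: "x \<notin> W \<longleftrightarrow> (\<exists>b<x. \<delta> {b<..<x} \<le> Some 0)"
  unfolding W_def using \<delta>_le_0_iff[OF def_set_interval] by blast

lemma def_rel_less: "def_rel S (<)" "def_rel S (\<lambda>x y. y < x)"
  by (intro def_relI dfb_intros)+

text \<open>If smallness of \<open>]y, x[\<close> broke down inside \<open>J\<close>, the infimum
  \<open>s\<close> of the good \<open>y\<close> would lie in \<open>J\<close>, hence off
  \<open>W\<close>. A small left interval of \<open>s\<close>, glued to \<open>]s, x[\<close>, would
  then produce a good point below \<open>s\<close>.\<close>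

lemma \<delta>_initial_segment_le_0:
  assumes J: "open_interval J" "J \<subseteq> - W" and x: "x \<in> J"
  shows "\<delta> {u \<in> J. u < x} \<le> Some 0"
proof -
  define Q where "Q = {y. y < x \<and> \<delta> {y<..<x} \<le> Some 0}"
  have Q_eq: "Q = {y. y < x \<and> \<not> (y < x \<and> \<delta> {y<..<x} = Some 1)}"
    unfolding Q_def using \<delta>_le_0_iff[OF def_set_interval] by blast
  have defQ: "def_set S Q"
    unfolding Q_eq by (intro def_setI dfb_conj dfb_not dfb_rel[OF def_rel_small_interval] dfb_less
        var_or_const_var var_or_const_const)
  have Q_up: "y' \<in> Q" if "y \<in> Q" "y \<le> y'" "y' < x" for y y'
  proof -
    have "{y'<..<x} \<subseteq> {y<..<x}"
      using that by auto
    then show ?thesis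
      using that \<delta>_le_0_subset[OF def_set_interval def_set_interval] by (auto simp: Q_def)
  qed
  \<comment> \<open>\<open>Q\<close> may have no least element, so no single interval need show that
    it is small; but each tail lies in one of the small intervals \<open>]y, x[\<close>.\<close>
  have Q0: "\<delta> Q \<le> Some 0"
  proof (rule \<delta>_le_0_if_tails_le_0[OF defQ def_rel_less(1)])
    fix y assume "y \<in> Q"
    have "def_set S {u \<in> Q. y < u}"
      by (intro def_setI dfb_intros dfb_mem[OF defQ])
    moreover have "{u \<in> Q. y < u} \<subseteq> {y<..<x}"
      by (auto simp: Q_def)
    ultimately show "\<delta> {u \<in> Q. y < u} \<le> Some 0"
      using \<open>y \<in> Q\<close> \<delta>_le_0_subset[OF _ def_set_interval] by (auto simp: Q_def)
  qed auto
  have "{u \<in> J. u < x} \<subseteq> Q"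
  proof (rule subsetI, rule ccontr)
    fix z assume "z \<in> {u \<in> J. u < x}" and "z \<notin> Q"
    then have z: "z \<in> J" "z < x"
      by auto
    obtain b where b: "b \<in> Q"
      using J(2) x not_in_W_iff unfolding Q_def by blast
    have "z \<le> y" if "y \<in> Q" for y
      using Q_up[OF that] z(2) \<open>z \<notin> Q\<close> by (meson leI less_imp_le)
    then obtain s where s: "\<And>y. y \<in> Q \<Longrightarrow> s \<le> y" "\<And>t. s < t \<Longrightarrow> \<exists>y\<in>Q. y < t" and "z \<le> s"
      using def_set_Inf[OF defQ b] by (metis not_le leD)
    have "s < x"
      using s(1)[OF b] b by (auto simp: Q_def)
    then have "s \<in> J"
      using J(1) z x \<open>z \<le> s\<close> unfolding open_interval_def by auto
    then obtain b' where b': "b' < s" "\<delta> {b'<..<s} \<le> Some 0"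
      using J(2) not_in_W_iff by blast
    have "{s<..<x} \<subseteq> Q"
      using s(2) Q_up by (meson greaterThanLessThan_iff less_imp_le subsetI)
    then have "\<delta> {s<..<x} \<le> Some 0"
      using \<delta>_le_0_subset[OF def_set_interval defQ] Q0 by blast
    then have le: "\<delta> ({b'<..<s} \<union> ({s} \<union> {s<..<x})) \<le> Some 0"
      using b'(2) by (intro \<delta>_le_0_Un def_set_Un def_set_interval def_set_singleton) (simp_all add: \<delta>_basic)
    have sub: "{b'<..<x} \<subseteq> {b'<..<s} \<union> ({s} \<union> {s<..<x})"
      by auto
    have "\<delta> {b'<..<x} \<le> Some 0"
      by (rule \<delta>_le_0_subset[OF def_set_interval _ sub le]) (intro def_set_Un def_set_interval def_set_singleton)
    then have "b' \<in> Q"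
      using b'(1) \<open>s < x\<close> by (auto simp: Q_def)
    then show False
      using s(1) b'(1) leD by blast
  qed
  moreover have "def_set S {u \<in> J. u < x}"
    by (intro def_setI dfb_intros dfb_mem[OF def_set_open_interval[OF J(1)]])
  ultimately show ?thesis
    using \<delta>_le_0_subset[OF _ defQ] Q0 by blast
qed

text \<open>The complement consists of finitely many points and intervals. On an interval all
  initial segments are small, and these are the tails for the reversed order.\<close>

lemma \<delta>_Compl_W: "\<delta> (- W) \<le> Some 0"
proof -
  obtain F \<I> where *: "finite F" "finite \<I>" "\<And>I. I \<in> \<I> \<Longrightarrow> open_interval I" "- W = F \<union> \<Union>\<I>"
    using def_set_decomposition[OF def_set_Compl[OF def_set_W]] by blast
  have "\<delta> I \<le> Some 0" if I: "I \<in> \<I>" for I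
  proof (rule \<delta>_le_0_if_tails_le_0[OF def_set_open_interval[OF *(3)[OF I]] def_rel_less(2)])
    show "\<delta> {u \<in> I. u < y} \<le> Some 0" if "y \<in> I" for y
      using \<delta>_initial_segment_le_0[OF *(3)[OF I] _ that] *(4) I by blast
  qed auto
  with *(2,3) have "def_set S (\<Union>\<I>) \<and> \<delta> (\<Union>\<I>) \<le> Some 0"
  proof (induction \<I> rule: finite_induct)
    case (insert I \<I>)
    then show ?case
      using def_set_open_interval by (simp add: def_set_Un \<delta>_le_0_Un)
  qed (simp add: def_set_const \<delta>_basic)
  then show ?thesis
    unfolding *(4) using \<delta>_le_0_Un[OF def_set_finite[OF *(1)] _ \<delta>_finite[OF *(1)]] by blast
qed

text \<open>The part of \<open>X\<close> off \<open>W\<close> is negligible by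
  \<open>\<delta>_Compl_W\<close>. Conversely, if \<open>]p, q[\<close> lies in \<open>W\<close>,
  then \<open>]p, x[\<close> has dimension 1 for each \<open>x\<close> in it.\<close>

lemma \<delta>_le_0_iff_finite_Int_W:
  assumes X: "def_set S X"
  shows "\<delta> X \<le> Some 0 \<longleftrightarrow> finite (W \<inter> X)"
proof
  assume "finite (W \<inter> X)"
  then have "\<delta> (W \<inter> X \<union> - W) \<le> Some 0"
    by (intro \<delta>_le_0_Un def_set_finite[of "W \<inter> X"] def_set_Compl[OF def_set_W] \<delta>_finite[of "W \<inter> X"] \<delta>_Compl_W)
  moreover have "X \<subseteq> W \<inter> X \<union> - W"
    by blast
  ultimately show "\<delta> X \<le> Some 0"
    using X def_set_W by (meson \<delta>_le_0_subset def_set_Un def_set_Int def_set_Compl)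
next
  assume X0: "\<delta> X \<le> Some 0"
  show "finite (W \<inter> X)"
  proof (rule finite_def_setI)
    show "def_set S (W \<inter> X)"
      using X def_set_W def_set_Int by blast
    fix p q :: 'a assume "p < q" and pq: "\<And>y. p < y \<Longrightarrow> y < q \<Longrightarrow> y \<in> W \<inter> X"
    then obtain x where x: "p < x" "x < q"
      using dense by blast
    then have "\<delta> {p<..<x} = Some 1"
      using pq[of x] unfolding W_def by blast
    moreover have "{p<..<x} \<subseteq> X"
      using pq x by auto
    ultimately show False
      using X0 \<delta>_le_0_subset[OF def_set_interval X] by fastforce
  qed
qed

text \<open>Fubini with finite nonempty fibres on both sides equates the dimensions of the
  projections; the one outside \<open>W\<close> is small, so the one inside \<open>W\<close> is
  small and hence finite.\<close>

lemma separated_W: "separated W"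
  unfolding separated_def
proof (intro allI impI)
  fix R assume R: "def_rel S R" "\<forall>x y. R x y \<longrightarrow> x \<notin> W \<and> y \<in> W"
    and fin: "\<forall>x. finite {y. R x y}" "\<forall>y. finite {x. R x y}"
  have def_proj: "def_set S {x. \<exists>y. R x y}" "def_set S {y. \<exists>x. R x y}"
    by (intro def_setI dfb_intros dfb_rel[OF R(1)])+
  have "shift_dim (\<delta> {x. \<exists>y. R x y}) 0 = shift_dim (\<delta> {y. \<exists>x. R x y}) 0"
    by (rule fubini[OF R(1)]) (use fin in \<open>auto intro!: \<delta>_finite_nonempty\<close>)
  moreover have "{x. \<exists>y. R x y} \<subseteq> - W"
    using R(2) by blast
  then have "\<delta> {x. \<exists>y. R x y} \<le> Some 0"
    using \<delta>_le_0_subset[OF def_proj(1) def_set_Compl[OF def_set_W]] \<delta>_Compl_W by blast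
  ultimately have "finite (W \<inter> {y. \<exists>x. R x y})"
    using \<delta>_le_0_iff_finite_Int_W[OF def_proj(2)] by simp
  moreover have "W \<inter> {y. \<exists>x. R x y} = {y. \<exists>x. R x y}"
    using R(2) by blast
  ultimately show "finite {y. \<exists>x. R x y}"
    by simp
qed

lemma infinite_W: "infinite W"
  using \<delta>_le_0_iff_finite_Int_W[OF def_set_const(1)] by (simp add: \<delta>_basic)

lemma dim_eq_vd_1: "X \<in> definable_sets S (Suc 0) \<Longrightarrow> d X = vd W (Suc 0) X"
proof (elim definable_set_1E)
  fix Y assume "X = points Y" and Y: "def_set S Y"
  then show "d X = vd W (Suc 0) X"
    using \<delta>_le_0_iff_finite_Int_W[OF Y] \<delta>_le_0_iff[OF Y] \<delta>_values[OF Y] \<delta>_basic(1)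
    unfolding \<open>X = points Y\<close> vd_points \<delta>_def[symmetric] by auto
qed

lemma dim_fibre_values:
  assumes "X \<in> definable_sets S (Suc n)" "x \<in> X"
  shows "\<exists>i\<in>{0, 1}. butlast x \<in> fibre_dim_set d X i"
proof -
  have x: "butlast x \<in> butlast ` X"
    using assms(2) by blast
  have "x \<noteq> []"
    using definable_sets_length[OF assms] by auto
  then have "{y. butlast x @ [y] \<in> X} \<noteq> {}"
    using assms(2) by (auto intro: exI[of _ "last x"])
  moreover have "def_set S {y. butlast x @ [y] \<in> X}"
    using definable_fibre[OF assms(1) x] by (simp add: fibre_eq_points definable_points_iff)
  ultimately show ?thesis
    using \<delta>_values[of "{y. butlast x @ [y] \<in> X}"] x
    by (auto simp: fibre_dim_set_def fibre_eq_points \<delta>_def)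
qed

text \<open>The sets \<open>X(i)\<close> depend only on dimensions of fibres, which are subsets of
  the line. The fibre axiom and the induction hypothesis for \<open>X(i)\<close> then determine the
  two parts of \<open>X\<close>.\<close>

lemma dimension_function_unique:
  assumes "dimension_function S d'" "\<And>X. X \<in> definable_sets S (Suc 0) \<Longrightarrow> d X = d' X"
  shows "X \<in> definable_sets S (Suc n) \<Longrightarrow> d X = d' X"
proof (induction n arbitrary: X)
  case (Suc n)
  interpret d': dimension_on_o_minimal S d'
    by unfold_locales (rule assms(1))
  let ?F = "fibre_dim_set d X"
  let ?X = "\<lambda>i. {x \<in> X. butlast x \<in> ?F i}"
  have F: "fibre_dim_set d' X i = ?F i" for i
    by (rule fibre_dim_set_cong[symmetric, OF assms(2) Suc.prems definable_fibre[OF Suc.prems]])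
  have eq: "d (?X i) = d' (?X i)" "?X i \<in> definable_sets S (Suc (Suc n))" if i: "i \<in> {0, 1}" for i
  proof -
    have "?F i \<in> definable_sets S (Suc n)"
      using dim_fibre(1)[OF _ Suc.prems i] by simp
    then show "?X i \<in> definable_sets S (Suc (Suc n))" "d (?X i) = d' (?X i)"
      using definable_butlast_vimage[OF Suc.prems] dim_fibre(2)[OF _ Suc.prems i]
        d'.dim_fibre(2)[OF _ Suc.prems i] Suc.IH by (simp_all add: F)
  qed
  have "X = ?X 0 \<union> ?X 1"
    using dim_fibre_values[OF Suc.prems] by blast
  then show ?case
    using eq[of 0] eq[of 1] dim_Un[of "Suc (Suc n)" "?X 0" "?X 1"] d'.dim_Un[of "Suc (Suc n)" "?X 0" "?X 1"]
    by simp
qed (rule assms(2))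

end

section \<open>Counting dimension functions\<close>

definition sym_diff_set :: "'b set \<Rightarrow> 'b set \<Rightarrow> 'b set" where
  "sym_diff_set A B = (A - B) \<union> (B - A)"

lemma sym_diff_set_simps [simp]:
  "sym_diff_set A {} = A" "sym_diff_set {} A = A" "sym_diff_set A A = {}"
  "sym_diff_set A (sym_diff_set A B) = B"
  by (auto simp: sym_diff_set_def)

lemma sym_diff_set_assoc: "sym_diff_set (sym_diff_set A B) C = sym_diff_set A (sym_diff_set B C)"
  and sym_diff_set_commute: "sym_diff_set A B = sym_diff_set B A"
  by (auto simp: sym_diff_set_def)

lemma sym_diff_set_left_commute:
  "sym_diff_set A (sym_diff_set B C) = sym_diff_set B (sym_diff_set A C)"
  by (auto simp: sym_diff_set_def)

text \<open>The symmetric difference makes \<open>B\<close> a vector space over the field with two elements; subspaces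
  \<open>H\<close> are enlarged one coset at a time.\<close>

lemma card_sym_diff_closed_extend:
  assumes "finite B" "\<And>x y. x \<in> B \<Longrightarrow> y \<in> B \<Longrightarrow> sym_diff_set x y \<in> B"
    and "H \<subseteq> B" "{} \<in> H" "\<And>x y. x \<in> H \<Longrightarrow> y \<in> H \<Longrightarrow> sym_diff_set x y \<in> H" "card H = 2 ^ k"
  shows "\<exists>m. card B = 2 ^ m"
  using assms(3-6)
proof (induction "card (B - H)" arbitrary: H k rule: less_induct)
  case less
  show ?case
  proof (cases "B = H")
    case False
    then obtain v where v: "v \<in> B" "v \<notin> H"
      using less.prems(1) by blast
    let ?H' = "sym_diff_set v ` H"
    have "inj_on (sym_diff_set v) H"
      by (rule inj_on_inverseI[of _ "sym_diff_set v"]) simp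
    then have "card ?H' = 2 ^ k"
      using less.prems(4) by (simp add: card_image)
    moreover have disj: "H \<inter> ?H' = {}"
    proof (rule ccontr)
      assume "H \<inter> ?H' \<noteq> {}"
      then obtain x where "x \<in> H" "sym_diff_set v x \<in> H"
        by blast
      then have "sym_diff_set x (sym_diff_set v x) \<in> H"
        by (rule less.prems(3))
      then show False
        using v(2) by (simp add: sym_diff_set_commute[of v])
    qed
    moreover have "finite H"
      using less.prems(1) assms(1) finite_subset by blast
    ultimately have card: "card (H \<union> ?H') = 2 ^ Suc k"
      using less.prems(4) by (simp add: card_Un_disjoint)
    have sub: "H \<union> ?H' \<subseteq> B"
      using less.prems(1) v(1) assms(2) by blast
    have "v \<in> ?H'"
      using less.prems(2) by (rule_tac image_eqI[of _ _ "{}"]) simp_all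
    then have "B - (H \<union> ?H') \<subset> B - H"
      using v by blast
    then have "card (B - (H \<union> ?H')) < card (B - H)"
      using assms(1) by (intro psubset_card_mono) auto
    moreover have "sym_diff_set x y \<in> H \<union> ?H'" if xy: "x \<in> H \<union> ?H'" "y \<in> H \<union> ?H'" for x y
    proof -
      have cl: "sym_diff_set a b \<in> H" if "a \<in> H" "b \<in> H" for a b
        using less.prems(3) that by blast
      from xy consider "x \<in> H" "y \<in> H" | a where "x = sym_diff_set v a" "a \<in> H" "y \<in> H"
        | b where "x \<in> H" "y = sym_diff_set v b" "b \<in> H"
        | a b where "x = sym_diff_set v a" "a \<in> H" "y = sym_diff_set v b" "b \<in> H"
        by blast
      then show ?thesis
      proof cases
        case 4
        \<comment> \<open>Both elements lie in the new coset, so the two copies of \<open>v\<close>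
          cancel.\<close>
        have "sym_diff_set x y = sym_diff_set a b"
          unfolding 4 sym_diff_set_assoc sym_diff_set_left_commute[of a v] by simp
        then show ?thesis
          using cl 4 by simp
      qed (use cl in \<open>auto simp: sym_diff_set_assoc sym_diff_set_left_commute[of _ v]\<close>)
    qed
    ultimately show ?thesis
      using less.hyps[OF _ sub _ _ card] less.prems(2) by blast
  qed (use less.prems in blast)
qed

lemma card_sym_diff_closed:
  assumes "finite B" "{} \<in> B" "\<And>x y. x \<in> B \<Longrightarrow> y \<in> B \<Longrightarrow> sym_diff_set x y \<in> B"
  shows "\<exists>m. card B = 2 ^ m"
  by (rule card_sym_diff_closed_extend[of B "{{}}" 0]) (use assms in auto)

section \<open>The Boolean algebra of regular sets\<close>

context o_minimal_structure
begin

text \<open>Unlike in a topological interior, membership of \<open>x\<close> ignores whether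
  \<open>x\<close> lies in \<open>V\<close> and looks only at the germ to its left; finite changes
  of \<open>V\<close> have no effect.\<close>

definition left_interior :: "'a set \<Rightarrow> 'a set" where
  "left_interior V = {x. \<exists>b<x. \<forall>y. b < y \<and> y < x \<longrightarrow> y \<in> V}"

text \<open>By \<open>left_germ\<close> exactly one of \<open>V\<close> and its complement fills an
  interval ending at \<open>x\<close>; a two-sided interior would fail this at boundary
  points.\<close>

lemma left_interior_Compl:
  assumes "def_set S V"
  shows "left_interior (- V) = - left_interior V"
proof (rule set_eqI)
  fix x
  obtain b where b: "b < x" "(\<forall>y. b < y \<and> y < x \<longrightarrow> y \<in> V) \<or> (\<forall>y. b < y \<and> y < x \<longrightarrow> y \<notin> V)"
    using left_germ[OF assms] by blast
  have "\<not> (x \<in> left_interior V \<and> x \<in> left_interior (- V))"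
  proof
    assume "x \<in> left_interior V \<and> x \<in> left_interior (- V)"
    then obtain b b' where "b < x" "b' < x" "\<And>y. b < y \<Longrightarrow> y < x \<Longrightarrow> y \<in> V"
        "\<And>y. b' < y \<Longrightarrow> y < x \<Longrightarrow> y \<notin> V"
      unfolding left_interior_def by blast
    moreover obtain y where "max b b' < y" "y < x"
      using dense[of "max b b'" x] \<open>b < x\<close> \<open>b' < x\<close> by auto
    ultimately show False
      by (metis max_less_iff_conj)
  qed
  moreover have "x \<in> left_interior V \<or> x \<in> left_interior (- V)"
    using b unfolding left_interior_def by auto
  ultimately show "x \<in> left_interior (- V) \<longleftrightarrow> x \<in> - left_interior V"
    by blast
qed

lemma left_interior_Int: "left_interior (V \<inter> U) = left_interior V \<inter> left_interior U"
proof
  show "left_interior V \<inter> left_interior U \<subseteq> left_interior (V \<inter> U)"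
  proof
    fix x assume "x \<in> left_interior V \<inter> left_interior U"
    then obtain b b' where "b < x" "\<forall>y. b < y \<and> y < x \<longrightarrow> y \<in> V" "b' < x" "\<forall>y. b' < y \<and> y < x \<longrightarrow> y \<in> U"
      unfolding left_interior_def by blast
    then show "x \<in> left_interior (V \<inter> U)"
      unfolding left_interior_def by (intro CollectI exI[of _ "max b b'"]) auto
  qed
qed (auto simp: left_interior_def)

text \<open>Every definable set agrees with its left interior up to a finite set, so that \<open>regular_sets\<close>
  contains exactly one representative modulo finite sets of each separated definable set.\<close>

definition regular_sets :: "'a set set" where
  "regular_sets = {V. def_set S V \<and> separated V \<and> left_interior V = V}"

lemma regular_sets_Compl: "V \<in> regular_sets \<Longrightarrow> - V \<in> regular_sets"
  by (auto simp: regular_sets_def def_set_Compl separated_Compl left_interior_Compl)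

lemma regular_sets_Int:
  assumes "V \<in> regular_sets" "U \<in> regular_sets"
  shows "V \<inter> U \<in> regular_sets"
proof -
  have "separated (- (- V \<union> - U))" "def_set S (- (- V \<union> - U))"
    using assms unfolding regular_sets_def mem_Collect_eq
    by (intro separated_Compl separated_Un def_set_Compl def_set_Un; blast)+
  then show ?thesis
    using assms by (simp add: regular_sets_def left_interior_Int)
qed

lemma regular_sets_sym_diff:
  assumes "V \<in> regular_sets" "U \<in> regular_sets"
  shows "sym_diff_set V U \<in> regular_sets"
proof -
  have "sym_diff_set V U = - (- (V \<inter> - U) \<inter> - (U \<inter> - V))"
    by (auto simp: sym_diff_set_def)
  then show ?thesis
    using assms by (simp only: regular_sets_Int regular_sets_Compl)
qed

lemma UNIV_regular: "UNIV \<in> regular_sets"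
  by (auto simp: regular_sets_def def_set_const separated_UNIV left_interior_def lt_ex)

lemma infinite_regular:
  assumes "V \<in> regular_sets" "V \<noteq> {}"
  shows "infinite V"
proof -
  obtain b x where "b < x" "\<forall>y. b < y \<and> y < x \<longrightarrow> y \<in> V"
    using assms unfolding regular_sets_def left_interior_def by blast
  then show ?thesis
    using infinite_def_set_iff assms(1) unfolding regular_sets_def by blast
qed

text \<open>A nonempty definable set determines its \<open>n\<close>, and for the empty set every
  \<open>n\<close> gives \<open>None\<close>, so the choice is harmless. The restriction makes the
  function extensional.\<close>

definition vdim :: "'a set \<Rightarrow> 'a list set \<Rightarrow> nat option" where
  "vdim V = restrict (\<lambda>X. vd V (SOME n. n > 0 \<and> X \<in> definable_sets S n) X) (all_definable_sets S)"

lemma vdim_eq: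
  assumes "n > 0" "X \<in> definable_sets S n"
  shows "vdim V X = vd V n X"
proof -
  define m where "m = (SOME n. n > 0 \<and> X \<in> definable_sets S n)"
  have "m > 0 \<and> X \<in> definable_sets S m"
    unfolding m_def by (rule someI[of _ n]) (use assms in blast)
  then have "vd V m X = vd V n X"
    using definable_sets_length[OF assms(2)] definable_sets_length[of X S m] vd_eq_None_iff[of V]
    by (metis ex_in_conv)
  moreover have "X \<in> all_definable_sets S"
    using assms unfolding all_definable_sets_def by auto
  ultimately show ?thesis
    by (simp add: vdim_def m_def)
qed

lemma vdim_mem: "V \<in> regular_sets \<Longrightarrow> V \<noteq> {} \<Longrightarrow> vdim V \<in> dimension_functions S"
  using dimension_function_vd[of V "vdim V"] infinite_regular
  by (auto simp: dimension_functions_def regular_sets_def vdim_eq) (simp add: vdim_def)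

text \<open>\<open>V\<close> is recovered from its dimension function by the same condition that
  defines \<open>W\<close>, which makes \<open>vdim\<close> injective on regular sets.\<close>

lemma regular_mem_iff:
  assumes "V \<in> regular_sets"
  shows "x \<in> V \<longleftrightarrow> (\<forall>b<x. vdim V (points {b<..<x}) = Some 1)"
proof -
  have "vdim V (points {b<..<x}) = Some 1 \<longleftrightarrow> infinite (V \<inter> {b<..<x})" if "b < x" for b
    using vdim_eq[of "Suc 0" "points {b<..<x}" V] that
    by (simp add: definable_points_iff def_set_interval vd_points del: vd.simps)
  moreover have "infinite (V \<inter> {b<..<x})" if x: "x \<in> V" and "b < x" for b
  proof -
    obtain b' where b': "b' < x" "\<And>y. b' < y \<Longrightarrow> y < x \<Longrightarrow> y \<in> V"
      using assms x unfolding regular_sets_def left_interior_def by blast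
    then have "{max b b'<..<x} \<subseteq> V \<inter> {b<..<x}"
      by auto
    then show ?thesis
      using infinite_between[of "max b b'" x] b'(1) \<open>b < x\<close> finite_subset max_less_iff_conj by blast
  qed
  moreover have "\<exists>b<x. finite (V \<inter> {b<..<x})" if "x \<notin> V"
  proof -
    have "x \<in> left_interior (- V)"
      using that regular_sets_Compl[OF assms] unfolding regular_sets_def by auto
    then obtain b where "b < x" "\<forall>y. b < y \<and> y < x \<longrightarrow> y \<notin> V"
      unfolding left_interior_def by blast
    then have "V \<inter> {b<..<x} = {}"
      by auto
    with \<open>b < x\<close> show ?thesis
      by (intro exI[of _ b]) simp
  qed
  ultimately show ?thesis
    by blast
qed

end

section \<open>Every dimension function comes from a regular set\<close>

context dimension_on_o_minimal
begin

text \<open>By \<open>\<delta>_le_0_iff_finite_Int_W\<close>, a point \<open>x\<close> lies in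
  \<open>W\<close> iff \<open>W\<close> meets every \<open>]b, x[\<close> in an infinite set, and
  this is decided by the left germ of \<open>W\<close> at \<open>x\<close>.\<close>

lemma W_regular: "W \<in> regular_sets"
proof -
  have "left_interior W = W"
  proof (rule set_eqI)
    fix x
    have "x \<in> W" if "x \<in> left_interior W"
    proof -
      obtain b where b: "b < x" "\<And>y. b < y \<Longrightarrow> y < x \<Longrightarrow> y \<in> W"
        using \<open>x \<in> left_interior W\<close> unfolding left_interior_def by blast
      have "\<not> \<delta> {b'<..<x} \<le> Some 0" if "b' < x" for b'
      proof -
        have "{max b b'<..<x} \<subseteq> W \<inter> {b'<..<x}"
          using b(2) by auto
        then have "infinite (W \<inter> {b'<..<x})"
          using infinite_between[of "max b b'" x] b(1) that finite_subset max_less_iff_conj by blast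
        then show ?thesis
          using \<delta>_le_0_iff_finite_Int_W[OF def_set_interval] by blast
      qed
      then show ?thesis
        using not_in_W_iff by blast
    qed
    moreover have "x \<in> left_interior W" if "x \<in> W"
    proof (rule ccontr)
      assume "x \<notin> left_interior W"
      then have "x \<in> left_interior (- W)"
        using left_interior_Compl[OF def_set_W] by blast
      then obtain b where "b < x" "\<forall>y. b < y \<and> y < x \<longrightarrow> y \<notin> W"
        unfolding left_interior_def by blast
      then have "W \<inter> {b<..<x} = {}"
        by auto
      then have "\<delta> {b<..<x} \<le> Some 0"
        using \<delta>_le_0_iff_finite_Int_W[OF def_set_interval] by simp
      then show False
        using \<open>b < x\<close> that not_in_W_iff by blast
    qed
    ultimately show "x \<in> left_interior W \<longleftrightarrow> x \<in> W"
      by blast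
  qed
  then show ?thesis
    by (simp add: regular_sets_def def_set_W separated_W)
qed

text \<open>The two functions agree on the line by the finiteness criterion, hence everywhere by
  \<open>dimension_function_unique\<close>.\<close>

lemma dim_eq_vdim:
  assumes "d \<in> extensional (all_definable_sets S)"
  shows "d = vdim W"
proof (rule extensionalityI[OF assms])
  show "vdim W \<in> extensional (all_definable_sets S)"
    by (simp add: vdim_def)
  have "dimension_function S (vdim W)"
    using vdim_mem[OF W_regular] infinite_W unfolding dimension_functions_def by fastforce
  moreover have "d X = vdim W X" if "X \<in> definable_sets S (Suc 0)" for X
    using dim_eq_vd_1[OF that] vdim_eq[OF _ that] by simp
  ultimately have "d X = vdim W X" if "X \<in> definable_sets S (Suc n)" for X n
    using dimension_function_unique that by blast
  then show "d X = vdim W X" if "X \<in> all_definable_sets S" for X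
    using that unfolding all_definable_sets_def by (auto dest!: gr0_implies_Suc)
qed

end

context o_minimal_structure
begin

lemma bij_betw_vdim: "bij_betw vdim (regular_sets - {{}}) (dimension_functions S)"
proof (rule bij_betw_imageI)
  show "inj_on vdim (regular_sets - {{}})"
  proof (rule inj_onI)
    fix V U assume *: "V \<in> regular_sets - {{}}" "U \<in> regular_sets - {{}}" "vdim V = vdim U"
    have "x \<in> V \<longleftrightarrow> x \<in> U" for x
      using regular_mem_iff[of V x] regular_mem_iff[of U x] * by simp
    then show "V = U"
      by blast
  qed
  have "d \<in> vdim ` (regular_sets - {{}})" if "d \<in> dimension_functions S" for d
  proof -
    interpret dimension_on_o_minimal S d
      by unfold_locales (use that in \<open>simp add: dimension_functions_def\<close>)
    have "d = vdim W"
      using dim_eq_vdim that by (simp add: dimension_functions_def)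
    then show ?thesis
      using W_regular infinite_W by (intro image_eqI[of _ _ W]) auto
  qed
  then show "vdim ` (regular_sets - {{}}) = dimension_functions S"
    using vdim_mem by blast
qed

end

theorem theorem3p23:
  fixes S :: "('a::unbounded_dense_linorder, 'f, 'r) fo_structure"
  assumes "o_minimal S"
    and "finite (dimension_functions S)"
  shows "\<exists>m::nat. m > 0 \<and> n_dim S = 2 ^ m - 1"
proof -
  interpret o_minimal_structure S
    by unfold_locales (rule assms(1))
  have empty: "{} \<in> regular_sets"
    using regular_sets_Compl[OF UNIV_regular] by simp
  have "finite (regular_sets - {{}})"
    using bij_betw_finite[OF bij_betw_vdim] assms(2) by blast
  then have fin: "finite regular_sets"
    by simp
  then obtain m where m: "card regular_sets = 2 ^ m"
    using card_sym_diff_closed[OF _ empty regular_sets_sym_diff] by blast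
  have "n_dim S = card (regular_sets - {{}})"
    unfolding n_dim_def using bij_betw_same_card[OF bij_betw_vdim] by simp
  \<comment> \<open>The empty set is excluded because with \<open>V = {}\<close> the line itself
    would get dimension 0.\<close>
  also have "\<dots> = 2 ^ m - 1"
    using fin empty m by (simp add: card_Diff_singleton)
  finally have "n_dim S = 2 ^ m - 1" .
  \<comment> \<open>The empty set and the whole line are two distinct regular sets.\<close>
  moreover have "m > 0"
  proof (rule ccontr)
    assume "\<not> m > 0"
    then have "card regular_sets = 1"
      using m by simp
    then show False
      using empty UNIV_regular by (metis UNIV_not_empty card_1_singletonE singletonD)
  qed
  ultimately show ?thesis
    by blast
qed

end
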